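(* A virtually free small Coxeter group does not have the congruence subgroup property. In particular, the congruence subgroup property fails for the triplet group $L_n$ when $n\ge 4$.
   Context: A Coxeter system $(W,S)$ of finite rank $r$ consists of a group $W$ and a finite set $S=\{w_1,\dots,w_r\}$ such that $W$ has the presentation $\langle S\mid (w_iw_j)^{m_{i,j}}=1\rangle$, where $m_{i,j}=m_{j,i}\in\mathbb{N}\cup\{\infty\}$, and $m_{i,j}=1$ if and only if $i=j$ (no relation is imposed when $m_{i,j}=\infty$). Only finite rank Coxeter systems are considered. A group is a small Coxeter group if it admits a Coxeter system in which every exponent $m_{i,j}$ is either $\infty$ or at most $3$; a small Coxeter group is considered together with such a system. For a property $\mathcal{P}$ of groups, a group is virtually $\mathcal{P}$ if it has a finite index subgroup with property $\mathcal{P}$; thus a group is virtually free if it has a finite index subgroup which is free. The triplet group is $L_n=\langle y_1,\dots,y_{n-1}\mid y_j^2=1 \text{ for } 1\le j\le n-1,\ y_iy_{i+1}y_i=y_{i+1}y_iy_{i+1} \text{ for } 1\le i\le n-2\rangle$, a small Coxeter group with generating set $\{y_1,\dots,y_{n-1}\}$ (exponent $3$ for $|i-j|=1$, exponent $\infty$ for $|i-j|\ge2$). Tits representation: let $V$ be the real vector space with basis $e_1,\dots,e_r$, and let $B$ be the symmetric bilinear form with $B(e_i,e_j)=-\cos(\pi/m_{i,j})$ if $m_{i,j}\neq\infty$ and $B(e_i,e_j)=-1$ if $m_{i,j}=\infty$. The Tits representation $\rho:W\to \mathrm{GL}(V)$ is given by $\rho(w_i)(v)=v-2B(e_i,v)e_i$.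 For a small Coxeter system its matrices in the basis $e_1,\dots,e_r$ have integer entries, so $\rho:W\to \mathrm{GL}(r,\mathbb{Z})$. For $m\ge 2$, the principal congruence subgroup $W[m]$ is the kernel of the composition of $\rho$ with the reduction $\mathrm{GL}(r,\mathbb{Z})\to \mathrm{GL}(r,\mathbb{Z}/m\mathbb{Z})$. $W$ has the congruence subgroup property if every finite index subgroup of $W$ contains $W[m]$ for some $m\ge2$.
   Formalization: "Virtually free" is taken to mean having a finite index free subgroup that is non-abelian (rank at least 2); finite and virtually infinite cyclic small Coxeter groups are excluded, since they do have the congruence subgroup property. *)

theory Defs
  imports
    Complex_Main
    "HOL-Library.Extended_Nat"
    "HOL-Number_Theory.Cong"
    "HOL-Algebra.Coset"
    "Jordan_Normal_Form.Matrix"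
begin

section \<open>Group presentations\<close>

text \<open>A letter \<open>(x, True)\<close> stands for the generator \<open>x\<close>, and \<open>(x, False)\<close> for its formal inverse.
  Relations are pairs of words, to be read as equations.\<close>

type_synonym 'i gword = "('i \<times> bool) list"

definition gwords :: "'i set \<Rightarrow> 'i gword set" where
  "gwords I = lists (I \<times> UNIV)"

inductive_set pres_rel :: "'i set \<Rightarrow> ('i gword \<times> 'i gword) set \<Rightarrow> ('i gword \<times> 'i gword) set"
  for I R where
  refl: "u \<in> gwords I \<Longrightarrow> (u, u) \<in> pres_rel I R"
| sym: "(u, v) \<in> pres_rel I R \<Longrightarrow> (v, u) \<in> pres_rel I R"
| trans: "(u, v) \<in> pres_rel I R \<Longrightarrow> (v, x) \<in> pres_rel I R \<Longrightarrow> (u, x) \<in> pres_rel I R"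
| cancel: "u \<in> gwords I \<Longrightarrow> v \<in> gwords I \<Longrightarrow> x \<in> I \<Longrightarrow>
    (u @ [(x, b), (x, \<not> b)] @ v, u @ v) \<in> pres_rel I R"
| relation: "u \<in> gwords I \<Longrightarrow> v \<in> gwords I \<Longrightarrow> p \<in> gwords I \<Longrightarrow> q \<in> gwords I \<Longrightarrow>
    (p, q) \<in> R \<Longrightarrow> (u @ p @ v, u @ q @ v) \<in> pres_rel I R"

definition presented_group ::
    "'i set \<Rightarrow> ('i gword \<times> 'i gword) set \<Rightarrow> 'i gword set monoid" where
  "presented_group I R =
    \<lparr> carrier = gwords I // pres_rel I R,
      mult = (\<lambda>A B. \<Union>u\<in>A. \<Union>v\<in>B. pres_rel I R `` {u @ v}),
      one = pres_rel I R `` {[]} \<rparr>"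

definition pres_gen :: "'i set \<Rightarrow> ('i gword \<times> 'i gword) set \<Rightarrow> 'i \<Rightarrow> 'i gword set" where
  "pres_gen I R i = pres_rel I R `` {[(i, True)]}"

definition has_presentation ::
    "('a, 'b) monoid_scheme \<Rightarrow> 'i set \<Rightarrow> ('i \<Rightarrow> 'a) \<Rightarrow> ('i gword \<times> 'i gword) set \<Rightarrow> bool" where
  "has_presentation G I g R \<longleftrightarrow>
    (\<exists>\<phi> \<in> iso (presented_group I R) G. \<forall>i\<in>I. \<phi> (pres_gen I R i) = g i)"

definition free_group :: "('a, 'b) monoid_scheme \<Rightarrow> bool" where
  "free_group G \<longleftrightarrow> group G \<and> (\<exists>X \<subseteq> carrier G. has_presentation G X (\<lambda>x. x) {})"

definition finite_index_subgroup :: "'a set \<Rightarrow> ('a, 'b) monoid_scheme \<Rightarrow> bool" where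
  "finite_index_subgroup H G \<longleftrightarrow> subgroup H G \<and> finite (rcosets\<^bsub>G\<^esub> H)"

definition virtually ::
    "(('a, 'b) monoid_scheme \<Rightarrow> bool) \<Rightarrow> ('a, 'b) monoid_scheme \<Rightarrow> bool" where
  "virtually P G \<longleftrightarrow> (\<exists>H. finite_index_subgroup H G \<and> P (G\<lparr>carrier := H\<rparr>))"

text \<open>The trivial group and the infinite cyclic group are free. The non-abelian free groups
  are the free groups of rank at least 2.\<close>

definition nonabelian_free_group :: "('a, 'b) monoid_scheme \<Rightarrow> bool" where
  "nonabelian_free_group G \<longleftrightarrow> free_group G \<and> \<not> comm_group G"


section \<open>Coxeter systems\<close>

text \<open>The generators are \<open>w 0, \<dots>, w (r - 1)\<close>; values of \<open>w\<close> and \<open>m\<close> at indices \<open>\<ge> r\<close> are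
  irrelevant.\<close>

definition coxeter_matrix :: "nat \<Rightarrow> (nat \<Rightarrow> nat \<Rightarrow> enat) \<Rightarrow> bool" where
  "coxeter_matrix r m \<longleftrightarrow>
    (\<forall>i<r. \<forall>j<r. 1 \<le> m i j \<and> m i j = m j i \<and> (m i j = 1 \<longleftrightarrow> i = j))"

definition coxeter_relations ::
    "nat \<Rightarrow> (nat \<Rightarrow> nat \<Rightarrow> enat) \<Rightarrow> (nat gword \<times> nat gword) set" where
  "coxeter_relations r m =
    {(concat (replicate k [(i, True), (j, True)]), []) | i j k. i < r \<and> j < r \<and> m i j = enat k}"

definition coxeter_system ::
    "('a, 'b) monoid_scheme \<Rightarrow> nat \<Rightarrow> (nat \<Rightarrow> 'a) \<Rightarrow> (nat \<Rightarrow> nat \<Rightarrow> enat) \<Rightarrow> bool" where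
  "coxeter_system W r w m \<longleftrightarrow>
    group W \<and> coxeter_matrix r m \<and> has_presentation W {..<r} w (coxeter_relations r m)"

definition small_coxeter_system ::
    "('a, 'b) monoid_scheme \<Rightarrow> nat \<Rightarrow> (nat \<Rightarrow> 'a) \<Rightarrow> (nat \<Rightarrow> nat \<Rightarrow> enat) \<Rightarrow> bool" where
  "small_coxeter_system W r w m \<longleftrightarrow>
    coxeter_system W r w m \<and> (\<forall>i<r. \<forall>j<r. m i j = \<infinity> \<or> m i j \<le> 3)"


section \<open>The Tits representation and principal congruence subgroups\<close>

definition tits_form_basis :: "(nat \<Rightarrow> nat \<Rightarrow> enat) \<Rightarrow> nat \<Rightarrow> nat \<Rightarrow> real" where
  "tits_form_basis m i j = (case m i j of enat k \<Rightarrow> - cos (pi / real k) | \<infinity> \<Rightarrow> - 1)"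

definition tits_form :: "nat \<Rightarrow> (nat \<Rightarrow> nat \<Rightarrow> enat) \<Rightarrow> real vec \<Rightarrow> real vec \<Rightarrow> real" where
  "tits_form r m u v = (\<Sum>i<r. \<Sum>j<r. u $ i * tits_form_basis m i j * v $ j)"

definition tits_reflection ::
    "nat \<Rightarrow> (nat \<Rightarrow> nat \<Rightarrow> enat) \<Rightarrow> nat \<Rightarrow> real vec \<Rightarrow> real vec" where
  "tits_reflection r m i v =
    v - (2 * tits_form r m (unit_vec r i) v) \<cdot>\<^sub>v unit_vec r i"

definition GL_real :: "nat \<Rightarrow> real mat monoid" where
  "GL_real r = units_of (ring_mat TYPE(real) r ())"

text \<open>The generators determine the homomorphism on the carrier; extensionality fixes its values
  elsewhere, so that the description is unique.\<close>

definition tits_rep ::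
    "('a, 'b) monoid_scheme \<Rightarrow> nat \<Rightarrow> (nat \<Rightarrow> 'a) \<Rightarrow> (nat \<Rightarrow> nat \<Rightarrow> enat) \<Rightarrow> 'a \<Rightarrow> real mat" where
  "tits_rep W r w m =
    (THE \<rho>. \<rho> \<in> hom W (GL_real r) \<and> \<rho> \<in> extensional (carrier W) \<and>
      (\<forall>i<r. \<forall>v \<in> carrier_vec r. \<rho> (w i) *\<^sub>v v = tits_reflection r m i v))"

text \<open>The kernel of reduction modulo \<open>k\<close>: the integer matrix \<open>A\<close> of \<open>\<rho> g\<close> is entrywise
  congruent to the identity.\<close>

definition principal_congruence_subgroup ::
    "('a, 'b) monoid_scheme \<Rightarrow> nat \<Rightarrow> (nat \<Rightarrow> 'a) \<Rightarrow> (nat \<Rightarrow> nat \<Rightarrow> enat) \<Rightarrow> nat \<Rightarrow> 'a set" where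
  "principal_congruence_subgroup W r w m k =
    {g \<in> carrier W. \<exists>A \<in> carrier_mat r r. tits_rep W r w m g = map_mat real_of_int A \<and>
      (\<forall>i<r. \<forall>j<r. [A $$ (i, j) = 1\<^sub>m r $$ (i, j)] (mod int k))}"

definition congruence_subgroup_property ::
    "('a, 'b) monoid_scheme \<Rightarrow> nat \<Rightarrow> (nat \<Rightarrow> 'a) \<Rightarrow> (nat \<Rightarrow> nat \<Rightarrow> enat) \<Rightarrow> bool" where
  "congruence_subgroup_property W r w m \<longleftrightarrow>
    (\<forall>H. finite_index_subgroup H W \<longrightarrow>
      (\<exists>k\<ge>2. principal_congruence_subgroup W r w m k \<subseteq> H))"


section \<open>Triplet groups\<close>

definition triplet_relations :: "nat \<Rightarrow> (nat gword \<times> nat gword) set" where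
  "triplet_relations n =
    {([(j, True), (j, True)], []) | j. 1 \<le> j \<and> j < n} \<union>
    {([(i, True), (i + 1, True), (i, True)], [(i + 1, True), (i, True), (i + 1, True)]) | i.
      1 \<le> i \<and> i + 1 < n}"

definition triplet_group :: "nat \<Rightarrow> nat gword set monoid" where
  "triplet_group n = presented_group {1..<n} (triplet_relations n)"

text \<open>Shift to the index range \<open>{..<n - 1}\<close> used for Coxeter systems: index \<open>i\<close> is the
  generator \<open>i + 1\<close> of the presentation.\<close>

definition triplet_gen :: "nat \<Rightarrow> nat \<Rightarrow> nat gword set" where
  "triplet_gen n i = pres_gen {1..<n} (triplet_relations n) (i + 1)"

definition triplet_exponent :: "nat \<Rightarrow> nat \<Rightarrow> enat" where
  "triplet_exponent i j = (if i = j then 1 else if i = j + 1 \<or> j = i + 1 then 3 else \<infinity>)"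

end

theory Submission
  imports Defs "HOL-Algebra.Elementary_Groups" "HOL-Algebra.Multiplicative_Group"
    "HOL-Combinatorics.Permutations"
begin

text \<open>
  The idea is that the congruence topology keeps different primes apart, while the profinite
  topology of a free group does not. Let \<open>x\<close> satisfy \<open>\<rho>(x\<^sup>k) \<equiv> 1\<close> modulo \<open>k\<close> for every \<open>k\<close>
  (\<open>congruence_torsion\<close>), and let \<open>y\<close> be a conjugate of \<open>x\<close>. Write a given level as
  \<open>k = 2\<^sup>a l\<close> with \<open>l\<close> odd. Then \<open>x\<^sup>l\<close> is trivial modulo \<open>l\<close>, and \<open>y\<close> raised to the power
  \<open>2\<^sup>a\<^sup>+\<^sup>1\<close> is trivial modulo \<open>2\<^sup>a\<close>, so the two matrices commute modulo both factors
  and their commutator lies in the principal congruence subgroup of level \<open>k\<close>. Hence the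
  congruence subgroup property would force an odd power of \<open>x\<close> and a power of \<open>y\<close> with a
  power of two as exponent to commute in each finite quotient of each subgroup of finite index
  (\<open>no_congruence_subgroup_property\<close>). It remains to find \<open>x\<close>, and a finite quotient in which
  such powers never commute.

  \<^emph>\<open>The element.\<close> If two roots \<open>\<alpha> \<noteq> \<plusminus>\<beta>\<close> have inner product \<open>\<plusminus>2\<close>, for the form scaled so
  that roots have norm \<open>2\<close>, then the product \<open>u\<close> of the two reflections is unipotent, and the explicit
  formula for \<open>u\<^sup>k\<close> shows \<open>\<rho>(u\<^sup>k) \<equiv> 1\<close> modulo \<open>k\<close>; moreover \<open>u\<close> has infinite order
  (\<open>parabolic_product\<close>), so some power of \<open>u\<close> is a nontrivial element of the given free
  subgroup of finite index.
  If no such pair of roots exists, a step-by-step argument along words bounds all inner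
  products of roots with simple roots by \<open>2\<close>, so that \<open>\<rho>\<close> has finite image
  (\<open>finite_rho_image\<close>), and then some power of a free generator lies in the kernel of \<open>\<rho>\<close>.

  \<^emph>\<open>The quotient.\<close> In a free group, draw a cyclically reduced conjugate of \<open>x\<close> as a labelled
  cycle, complete the partial action of the generators to permutations of the vertices, and
  pass to a covering with five sheets. The twists of the covering can be prescribed so that,
  over one vertex, this conjugate acts as \<open>\<pi> = (0 1)(2 3 4)\<close> and a further one acts as
  \<open>\<kappa>\<pi>\<kappa>\<inverse>\<close> with \<open>\<kappa> = (0 2)\<close> (\<open>free_group_separates_conjugates\<close>). Odd powers of \<open>\<pi>\<close> swap
  \<open>0\<close> and \<open>1\<close>, whereas \<open>\<kappa>\<pi>\<kappa>\<inverse> = (1 2)(0 3 4)\<close> raised to a power of two different from \<open>1\<close> fixes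
  \<open>1\<close> and moves \<open>0\<close>.

  For triplet groups with \<open>n \<ge> 4\<close>, the element \<open>y\<^sub>1y\<^sub>3\<close> is such a product of reflections, and an explicit
  action on seven points separates it from its conjugate by \<open>y\<^sub>2\<close>.
\<close>

section \<open>Words and the universal property of a presentation\<close>

fun word_eval :: "('a, 'b) monoid_scheme \<Rightarrow> ('i \<Rightarrow> 'a) \<Rightarrow> 'i gword \<Rightarrow> 'a" where
  "word_eval G f [] = \<one>\<^bsub>G\<^esub>"
| "word_eval G f ((x, b) # u) = (if b then f x else inv\<^bsub>G\<^esub> (f x)) \<otimes>\<^bsub>G\<^esub> word_eval G f u"

definition inverse_word :: "'i gword \<Rightarrow> 'i gword" where
  "inverse_word u = rev (map (\<lambda>(x, b). (x, \<not> b)) u)"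

lemma gwords_simps [simp]:
  "[] \<in> gwords I"
  "l # u \<in> gwords I \<longleftrightarrow> fst l \<in> I \<and> u \<in> gwords I"
  "u @ v \<in> gwords I \<longleftrightarrow> u \<in> gwords I \<and> v \<in> gwords I"
  by (cases l; auto simp: gwords_def)+

lemma inverse_word_in_gwords: "u \<in> gwords I \<Longrightarrow> inverse_word u \<in> gwords I"
  by (induction u) (auto simp: inverse_word_def)

context group
begin

lemma word_eval_closed:
  assumes "f \<in> I \<rightarrow> carrier G" "u \<in> gwords I"
  shows "word_eval G f u \<in> carrier G"
  using assms(2)
proof (induction u)
  case (Cons l u)
  then have "f (fst l) \<in> carrier G" using assms(1) by auto
  then show ?case using Cons by (cases l) auto
qed simp

lemma word_eval_append:
  assumes f: "f \<in> I \<rightarrow> carrier G" and "u \<in> gwords I" "v \<in> gwords I"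
  shows "word_eval G f (u @ v) = word_eval G f u \<otimes> word_eval G f v"
  using assms(2)
proof (induction u)
  case Nil
  then show ?case using word_eval_closed[OF f assms(3)] by simp
next
  case (Cons l u)
  obtain x b where l: "l = (x, b)" by (cases l)
  have x: "f x \<in> carrier G" using Cons.prems f l by auto
  have u: "word_eval G f u \<in> carrier G" "word_eval G f v \<in> carrier G"
    using Cons.prems word_eval_closed[OF f] assms(3) by auto
  then show ?case using Cons x l by (auto simp: m_assoc)
qed

lemma word_eval_hom:
  assumes h: "h \<in> hom G K" and K: "group K" and f: "f \<in> I \<rightarrow> carrier G" and "u \<in> gwords I"
  shows "h (word_eval G f u) = word_eval K (\<lambda>i. h (f i)) u"
proof -
  interpret h: group_hom G K h
    using h K by (auto simp: group_hom_def group_hom_axioms_def is_group)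
  show ?thesis
    using assms(4)
  proof (induction u)
    case Nil
    then show ?case by simp
  next
    case (Cons l u)
    obtain x b where l: "l = (x, b)" by (cases l)
    have x: "f x \<in> carrier G" using Cons.prems f l by auto
    have u: "word_eval G f u \<in> carrier G"
      using Cons.prems word_eval_closed[OF f] by auto
    show ?case using Cons x u l by auto
  qed
qed

lemma word_eval_cong:
  assumes "\<And>i. i \<in> I \<Longrightarrow> f i = g i" "u \<in> gwords I"
  shows "word_eval G f u = word_eval G g u"
  using assms(2) by (induction u) (use assms(1) in \<open>auto split: if_splits\<close>)

lemma word_eval_respects_relations:
  assumes f: "f \<in> I \<rightarrow> carrier G"
    and R: "\<And>p q. (p, q) \<in> R \<Longrightarrow> p \<in> gwords I \<Longrightarrow> q \<in> gwords I \<Longrightarrow>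
              word_eval G f p = word_eval G f q"
    and "(u, v) \<in> pres_rel I R"
  shows "word_eval G f u = word_eval G f v"
  using assms(3)
proof (induction rule: pres_rel.induct)
  case (cancel u v x b)
  have x: "f x \<in> carrier G" using f cancel by auto
  have c: "word_eval G f u \<in> carrier G" "word_eval G f v \<in> carrier G"
    using cancel word_eval_closed[OF f] by auto
  have "word_eval G f [(x, b), (x, \<not> b)] = \<one>"
    using x by auto
  moreover have "word_eval G f (u @ [(x, b), (x, \<not> b)] @ v)
      = word_eval G f u \<otimes> (word_eval G f [(x, b), (x, \<not> b)] \<otimes> word_eval G f v)"
    using cancel by (subst word_eval_append[OF f] | simp)+
  ultimately show ?case
    using c cancel word_eval_append[OF f] by auto
next
  case (relation u v p q)
  then show ?case
    using R[of p q] by (simp add: word_eval_append[OF f])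
qed auto

end

lemma pres_rel_gwords: "(u, v) \<in> pres_rel I R \<Longrightarrow> u \<in> gwords I \<and> v \<in> gwords I"
  by (induction rule: pres_rel.induct) auto

text \<open>Stability of the relation under contexts is what makes multiplication of classes well defined.\<close>

lemma pres_rel_append_cong:
  assumes "(u, v) \<in> pres_rel I R" "x \<in> gwords I" "y \<in> gwords I"
  shows "(x @ u @ y, x @ v @ y) \<in> pres_rel I R"
  using assms
proof (induction rule: pres_rel.induct)
  case (refl u)
  then show ?case by (auto intro: pres_rel.refl)
next
  case (sym u v)
  then show ?case by (auto intro: pres_rel.sym)
next
  case (trans u v x)
  then show ?case by (blast intro: pres_rel.trans)
next
  case (cancel u v z b)
  then have "((x @ u) @ [(z, b), (z, \<not> b)] @ (v @ y), (x @ u) @ (v @ y)) \<in> pres_rel I R"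
    by (intro pres_rel.cancel) auto
  then show ?case by simp
next
  case (relation u v p q)
  then have "((x @ u) @ p @ (v @ y), (x @ u) @ q @ (v @ y)) \<in> pres_rel I R"
    by (intro pres_rel.relation) auto
  then show ?case by simp
qed

lemma pres_rel_append:
  assumes "(u, u') \<in> pres_rel I R" "(v, v') \<in> pres_rel I R"
  shows "(u @ v, u' @ v') \<in> pres_rel I R"
proof -
  have "([] @ u @ v, [] @ u' @ v) \<in> pres_rel I R"
    using assms pres_rel_gwords by (intro pres_rel_append_cong) auto
  moreover have "(u' @ v @ [], u' @ v' @ []) \<in> pres_rel I R"
    using assms pres_rel_gwords by (intro pres_rel_append_cong) auto
  ultimately show ?thesis using pres_rel.trans by fastforce
qed

lemma equiv_pres_rel: "equiv (gwords I) (pres_rel I R)"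
  by (rule equivI)
    (auto simp: refl_on_def sym_def trans_def
      dest: pres_rel_gwords intro: pres_rel.refl pres_rel.sym pres_rel.trans)

definition word_class :: "'i set \<Rightarrow> ('i gword \<times> 'i gword) set \<Rightarrow> 'i gword \<Rightarrow> 'i gword set" where
  "word_class I R u = pres_rel I R `` {u}"

lemma word_class_eq_iff:
  "u \<in> gwords I \<Longrightarrow> v \<in> gwords I \<Longrightarrow>
    word_class I R u = word_class I R v \<longleftrightarrow> (u, v) \<in> pres_rel I R"
  unfolding word_class_def by (rule eq_equiv_class_iff[OF equiv_pres_rel])

lemma carrier_presented_group: "carrier (presented_group I R) = word_class I R ` gwords I"
  by (auto simp: presented_group_def quotient_def word_class_def)

lemma word_class_mult:
  assumes "u \<in> gwords I" "v \<in> gwords I"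
  shows "word_class I R u \<otimes>\<^bsub>presented_group I R\<^esub> word_class I R v = word_class I R (u @ v)"
proof -
  have "(\<Union>a\<in>word_class I R u. \<Union>b\<in>word_class I R v. pres_rel I R `` {a @ b})
      = word_class I R (u @ v)"
  proof -
    have "pres_rel I R `` {a @ b} = word_class I R (u @ v)"
      if "a \<in> word_class I R u" "b \<in> word_class I R v" for a b
    proof -
      have "(u @ v, a @ b) \<in> pres_rel I R"
        using that by (auto simp: word_class_def intro: pres_rel_append)
      then show ?thesis
        using word_class_eq_iff[of "u @ v" I "a @ b" R] pres_rel_gwords
        unfolding word_class_def by blast
    qed
    moreover have "u \<in> word_class I R u" "v \<in> word_class I R v"
      using assms by (auto simp: word_class_def intro: pres_rel.refl)
    ultimately show ?thesis by blast
  qed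
  then show ?thesis by (simp add: presented_group_def)
qed

lemma word_class_one: "\<one>\<^bsub>presented_group I R\<^esub> = word_class I R []"
  by (simp add: presented_group_def word_class_def)

lemma pres_gen_word_class: "pres_gen I R i = word_class I R [(i, True)]"
  by (simp add: pres_gen_def word_class_def)

text \<open>Reversing a word and flipping its signs gives inverses, so a presented group is a group
  whatever the relations are.\<close>

lemma inverse_word_cancels:
  "u \<in> gwords I \<Longrightarrow> (inverse_word u @ u, []) \<in> pres_rel I R"
proof (induction u)
  case Nil
  then show ?case by (auto simp: inverse_word_def intro: pres_rel.refl)
next
  case (Cons l u)
  obtain x b where l: "l = (x, b)" by (cases l)
  have "(inverse_word u @ [(x, \<not> b), (x, \<not> \<not> b)] @ u, inverse_word u @ u) \<in> pres_rel I R"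
    using Cons.prems l inverse_word_in_gwords by (intro pres_rel.cancel) auto
  then have "(inverse_word (l # u) @ l # u, inverse_word u @ u) \<in> pres_rel I R"
    by (simp add: inverse_word_def l)
  then show ?case using Cons pres_rel.trans by fastforce
qed

lemma group_presented_group: "group (presented_group I R)"
proof (rule groupI)
  fix A assume "A \<in> carrier (presented_group I R)"
  then obtain u where u: "u \<in> gwords I" "A = word_class I R u"
    by (auto simp: carrier_presented_group)
  have "word_class I R (inverse_word u) \<otimes>\<^bsub>presented_group I R\<^esub> A = \<one>\<^bsub>presented_group I R\<^esub>"
    using u inverse_word_in_gwords[OF u(1)] inverse_word_cancels[OF u(1)]
    by (simp add: word_class_mult word_class_one word_class_eq_iff)
  then show "\<exists>B\<in>carrier (presented_group I R). B \<otimes>\<^bsub>presented_group I R\<^esub> A = \<one>\<^bsub>presented_group I R\<^esub>"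
    using inverse_word_in_gwords[OF u(1)] by (auto simp: carrier_presented_group)
qed (auto simp: carrier_presented_group word_class_mult word_class_one)

lemma has_presentation_presented_group:
  "has_presentation (presented_group I R) I (pres_gen I R) R"
  unfolding has_presentation_def
  by (rule bexI[of _ "\<lambda>x. x"]) (auto simp: iso_def hom_def bij_betw_def)

text \<open>A presentation only fixes the images of the positive letters. As \<open>(x, True)(x, False)\<close>
  represents the identity, the images of the negative letters are forced, and therefore the
  isomorphism is evaluation of words.\<close>

lemma has_presentation_word_iso:
  assumes G: "group G" and pres: "has_presentation G I g R"
  obtains \<phi> where "bij_betw \<phi> (carrier (presented_group I R)) (carrier G)"
    "\<And>u. u \<in> gwords I \<Longrightarrow> \<phi> (word_class I R u) = word_eval G g u"
    "g \<in> I \<rightarrow> carrier G"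
proof -
  interpret G: group G by fact
  obtain \<phi> where iso: "\<phi> \<in> iso (presented_group I R) G"
    and gen: "\<And>i. i \<in> I \<Longrightarrow> \<phi> (pres_gen I R i) = g i"
    using pres by (auto simp: has_presentation_def)
  interpret P: group "presented_group I R" by (rule group_presented_group)
  interpret \<phi>: group_hom "presented_group I R" G \<phi>
    using iso by (unfold_locales) (simp add: iso_def)
  have g: "g \<in> I \<rightarrow> carrier G"
  proof
    fix i assume i: "i \<in> I"
    have "\<phi> (pres_gen I R i) \<in> carrier G"
      using i by (intro \<phi>.hom_closed) (auto simp: pres_gen_word_class carrier_presented_group)
    then show "g i \<in> carrier G" using gen[OF i] by simp
  qed
  have letter: "\<phi> (word_class I R [(x, b)]) = (if b then g x else inv\<^bsub>G\<^esub> g x)" if x: "x \<in> I" for x b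
  proof -
    have c: "word_class I R [(x, c)] \<in> carrier (presented_group I R)" for c
      using x by (auto simp: carrier_presented_group)
    have "word_class I R [(x, True)] \<otimes>\<^bsub>presented_group I R\<^esub> word_class I R [(x, False)]
        = word_class I R ([] @ [(x, True), (x, \<not> True)] @ [])"
      using x by (simp add: word_class_mult)
    also have "\<dots> = \<one>\<^bsub>presented_group I R\<^esub>"
      unfolding word_class_one using x pres_rel.cancel[of "[]" I "[]" x True R]
      by (subst word_class_eq_iff) auto
    finally have "word_class I R [(x, False)] = inv\<^bsub>presented_group I R\<^esub> word_class I R [(x, True)]"
      using c by (metis P.inv_equality P.inv_inv)
    then show ?thesis
      using gen[OF x] c by (simp add: pres_gen_word_class)
  qed
  have "\<phi> (word_class I R u) = word_eval G g u" if "u \<in> gwords I" for u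
    using that
  proof (induction u)
    case Nil
    then show ?case using \<phi>.hom_one by (simp add: word_class_one)
  next
    case (Cons l u)
    obtain x b where l: "l = (x, b)" by (cases l)
    have "word_class I R (l # u) = word_class I R [l] \<otimes>\<^bsub>presented_group I R\<^esub> word_class I R u"
      using Cons.prems by (simp add: word_class_mult)
    moreover have "\<phi> \<dots> = \<phi> (word_class I R [l]) \<otimes>\<^bsub>G\<^esub> \<phi> (word_class I R u)"
      using Cons.prems by (intro \<phi>.hom_mult) (auto simp: carrier_presented_group)
    ultimately show ?case using Cons l letter by simp
  qed
  then show thesis using that[of \<phi>] iso g by (simp add: iso_def)
qed

lemma has_presentation_generates:
  assumes "group G" "has_presentation G I g R"
  shows "g \<in> I \<rightarrow> carrier G" "carrier G = word_eval G g ` gwords I"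
proof -
  obtain \<phi> where \<phi>: "bij_betw \<phi> (carrier (presented_group I R)) (carrier G)"
    "\<And>u. u \<in> gwords I \<Longrightarrow> \<phi> (word_class I R u) = word_eval G g u" "g \<in> I \<rightarrow> carrier G"
    using has_presentation_word_iso[OF assms] by blast
  show "g \<in> I \<rightarrow> carrier G" by fact
  show "carrier G = word_eval G g ` gwords I"
    using \<phi>(1,2) by (force simp: bij_betw_def carrier_presented_group)
qed

text \<open>The universal property: a homomorphism out of a presented group may be prescribed on the
  generators as soon as the relations hold in the target. It can be read off from any word
  representing an element, because two such words are related.\<close>

lemma has_presentation_lift:
  assumes G: "group G" and pres: "has_presentation G I g R"
    and K: "group K" and f: "f \<in> I \<rightarrow> carrier K"
    and R: "\<And>p q. (p, q) \<in> R \<Longrightarrow> p \<in> gwords I \<Longrightarrow> q \<in> gwords I \<Longrightarrow>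
              word_eval K f p = word_eval K f q"
  obtains h where "h \<in> hom G K" "\<And>i. i \<in> I \<Longrightarrow> h (g i) = f i"
    "\<And>u. u \<in> gwords I \<Longrightarrow> h (word_eval G g u) = word_eval K f u"
proof -
  interpret G: group G by fact
  interpret K: group K by fact
  obtain \<phi> where \<phi>: "bij_betw \<phi> (carrier (presented_group I R)) (carrier G)"
    "\<And>u. u \<in> gwords I \<Longrightarrow> \<phi> (word_class I R u) = word_eval G g u" and g: "g \<in> I \<rightarrow> carrier G"
    using has_presentation_word_iso[OF G pres] by blast
  define h where "h x = word_eval K f (SOME u. u \<in> gwords I \<and> word_eval G g u = x)" for x
  have h: "h (word_eval G g u) = word_eval K f u" if u: "u \<in> gwords I" for u
  proof -
    define v where "v = (SOME v. v \<in> gwords I \<and> word_eval G g v = word_eval G g u)"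
    have v: "v \<in> gwords I \<and> word_eval G g v = word_eval G g u"
      unfolding v_def by (rule someI[of _ u]) (use u in simp)
    then have "\<phi> (word_class I R v) = \<phi> (word_class I R u)" using \<phi>(2) u by simp
    then have "word_class I R v = word_class I R u"
      using \<phi>(1) u v by (auto simp: bij_betw_def carrier_presented_group inj_on_def)
    then have vu: "(v, u) \<in> pres_rel I R" using u v word_class_eq_iff by blast
    have "word_eval K f v = word_eval K f u"
      by (rule K.word_eval_respects_relations[OF f _ vu]) (rule R)
    then show ?thesis by (simp add: h_def v_def)
  qed
  have "h \<in> hom G K"
  proof (rule homI)
    fix x y assume "x \<in> carrier G" "y \<in> carrier G"
    then obtain u v where uv: "u \<in> gwords I" "v \<in> gwords I" "x = word_eval G g u" "y = word_eval G g v"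
      using has_presentation_generates(2)[OF G pres] by auto
    then have "x \<otimes>\<^bsub>G\<^esub> y = word_eval G g (u @ v)" using G.word_eval_append[OF g] by simp
    then show "h (x \<otimes>\<^bsub>G\<^esub> y) = h x \<otimes>\<^bsub>K\<^esub> h y"
      using uv by (simp add: h K.word_eval_append[OF f])
    show "h x \<in> carrier K" using uv by (simp add: h K.word_eval_closed[OF f])
  qed
  moreover have "h (g i) = f i" if "i \<in> I" for i
  proof -
    have "g i \<in> carrier G" "f i \<in> carrier K" using g f that by auto
    then show ?thesis using h[of "[(i, True)]"] that by simp
  qed
  ultimately show thesis using that h by blast
qed

section \<open>Finite permutation groups\<close>

definition perm_group :: "'a set \<Rightarrow> ('a \<Rightarrow> 'a) monoid" where
  "perm_group S = \<lparr>carrier = {p. p permutes S}, mult = (\<circ>), one = id\<rparr>"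

lemma perm_group_simps [simp]:
  "p \<in> carrier (perm_group S) \<longleftrightarrow> p permutes S"
  "p \<otimes>\<^bsub>perm_group S\<^esub> q = p \<circ> q"
  "\<one>\<^bsub>perm_group S\<^esub> = id"
  by (simp_all add: perm_group_def)

lemma group_perm_group: "group (perm_group S)"
proof (rule groupI)
  fix p assume "p \<in> carrier (perm_group S)"
  then show "\<exists>q\<in>carrier (perm_group S). q \<otimes>\<^bsub>perm_group S\<^esub> p = \<one>\<^bsub>perm_group S\<^esub>"
    by (intro bexI[of _ "inv_into UNIV p"]) (auto simp: permutes_inv_o permutes_inv)
qed (auto simp: permutes_compose permutes_id o_assoc)

lemma inv_perm_group: "p permutes S \<Longrightarrow> inv\<^bsub>perm_group S\<^esub> p = inv_into UNIV p"
  by (rule group.inv_equality[OF group_perm_group]) (auto simp: permutes_inv_o permutes_inv)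

lemma pow_perm_group: "p [^]\<^bsub>perm_group S\<^esub> (n::nat) = p ^^ n"
proof -
  interpret group "perm_group S" by (rule group_perm_group)
  show ?thesis by (induction n) (simp_all add: funpow_swap1 fun_eq_iff)
qed

lemma finite_perm_group: "finite S \<Longrightarrow> finite (carrier (perm_group S))"
  by (simp add: perm_group_def finite_permutations)

text \<open>This is how a finite labelled graph, in which each label is a partial injection, becomes a
  finite permutation representation.\<close>

lemma extend_partial_injection:
  assumes S: "finite S" and R: "R \<subseteq> S \<times> S"
    and functional: "\<And>a b b'. (a, b) \<in> R \<Longrightarrow> (a, b') \<in> R \<Longrightarrow> b = b'"
    and injective: "\<And>a a' b. (a, b) \<in> R \<Longrightarrow> (a', b) \<in> R \<Longrightarrow> a = a'"
  obtains p where "p permutes S" "\<And>a b. (a, b) \<in> R \<Longrightarrow> p a = b"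
proof -
  define f where "f a = (THE b. (a, b) \<in> R)" for a
  have f: "f a = b" if "(a, b) \<in> R" for a b
    unfolding f_def using that by (rule the_equality) (rule functional[OF _ that])
  have bij1: "bij_betw f (Domain R) (Range R)"
  proof (rule bij_betwI')
    show "f a = f a' \<longleftrightarrow> a = a'" if "a \<in> Domain R" "a' \<in> Domain R" for a a'
      using that f injective by (metis DomainE)
    show "f a \<in> Range R" if "a \<in> Domain R" for a using that f by (metis DomainE RangeI)
    show "\<exists>a\<in>Domain R. b = f a" if "b \<in> Range R" for b using that f by (metis DomainI RangeE)
  qed
  have sub: "Domain R \<subseteq> S" "Range R \<subseteq> S" using R by auto
  then have fin: "finite (Domain R)" "finite (Range R)" using S finite_subset by blast+
  have "card (S - Domain R) = card (S - Range R)"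
    using bij_betw_same_card[OF bij1] by (simp add: card_Diff_subset fin sub)
  then obtain g where g: "bij_betw g (S - Domain R) (S - Range R)"
    using S by (meson finite_Diff finite_same_card_bij)
  define p where "p a = (if a \<in> Domain R then f a else if a \<in> S then g a else a)" for a
  have "bij_betw p (Domain R) (Range R)"
    using bij1 by (simp add: p_def cong: bij_betw_cong)
  moreover have "bij_betw p (S - Domain R) (S - Range R)"
    using g by (subst bij_betw_cong[of _ _ g]) (auto simp: p_def)
  ultimately have "bij_betw p (Domain R \<union> (S - Domain R)) (Range R \<union> (S - Range R))"
    by (intro bij_betw_combine) auto
  then have "bij_betw p S S" using sub by (simp add: Un_absorb1)
  then have "p permutes S"
    by (rule bij_imp_permutes) (use sub in \<open>auto simp: p_def\<close>)
  moreover have "p a = b" if "(a, b) \<in> R" for a b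
    using that f[OF that] by (auto simp: p_def)
  ultimately show thesis using that by blast
qed


section \<open>Pairs whose odd part and 2-power part never commute\<close>

text \<open>Odd powers of \<open>c\<close> keep the 2-part of \<open>c\<close>, and powers of \<open>d\<close> whose exponent is a power of
  two keep its odd part. The exponents exclude \<open>1\<close> for \<open>d\<close>, so that cycles of length two of \<open>d\<close> are killed.\<close>

definition separated_pair :: "('a, 'b) monoid_scheme \<Rightarrow> 'a \<Rightarrow> 'a \<Rightarrow> bool" where
  "separated_pair Q c d \<longleftrightarrow> (\<forall>(s::nat) e. odd s \<longrightarrow>
    c [^]\<^bsub>Q\<^esub> s \<otimes>\<^bsub>Q\<^esub> d [^]\<^bsub>Q\<^esub> (2 ^ Suc e :: nat) \<noteq> d [^]\<^bsub>Q\<^esub> (2 ^ Suc e :: nat) \<otimes>\<^bsub>Q\<^esub> c [^]\<^bsub>Q\<^esub> s)"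

lemma funpow_fixed: "f x = x \<Longrightarrow> (f ^^ n) x = x"
  by (induction n) auto

lemma funpow_mod_period: "(f ^^ k) x = x \<Longrightarrow> (f ^^ n) x = (f ^^ (n mod k)) x"
proof -
  assume x: "(f ^^ k) x = x"
  have "(f ^^ n) x = (f ^^ (n mod k)) (((f ^^ k) ^^ (n div k)) x)"
    by (metis funpow_add funpow_mult comp_apply mod_mult_div_eq mult.commute)
  also have "((f ^^ k) ^^ (n div k)) x = x" using x by (rule funpow_fixed)
  finally show ?thesis .
qed

lemma power_two_mod_3: "(2::nat) ^ n mod 3 \<noteq> 0"
proof (induction n)
  case (Suc n)
  have "2 * k mod 3 \<noteq> 0" if "k mod 3 \<noteq> 0" for k :: nat using that by presburger
  from this[OF Suc] show ?case by simp
qed simp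

text \<open>An odd power of \<open>c\<close> swaps \<open>p\<close> and \<open>q\<close>. A power of \<open>d\<close> with exponent \<open>2, 4, 8, \<dots>\<close>
  fixes \<open>q\<close>, which has period dividing two, but moves \<open>p\<close>, which has period three. A
  permutation commuting with the former would fix both points or none.\<close>

lemma separated_pair_perm_group:
  assumes swap: "c p = q" "c q = p"
    and d: "d (d q) = q" "d (d (d p)) = p" "d p \<noteq> p"
  shows "separated_pair (perm_group S) c d"
  unfolding separated_pair_def pow_perm_group perm_group_simps
proof (intro allI impI notI)
  fix s e :: nat
  assume s: "odd s" and comm: "c ^^ s \<circ> d ^^ 2 ^ Suc e = d ^^ 2 ^ Suc e \<circ> c ^^ s"
  have "(c ^^ s) p = (c ^^ (s mod 2)) p" "(c ^^ s) q = (c ^^ (s mod 2)) q"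
    by (rule funpow_mod_period; simp add: numeral_2_eq_2 swap)+
  then have cs: "(c ^^ s) p = q" "(c ^^ s) q = p"
    using s swap by (simp_all add: odd_iff_mod_2_eq_one)
  have dq: "(d ^^ 2 ^ Suc e) q = q"
  proof -
    have "(d ^^ 2) q = q" by (simp add: numeral_2_eq_2 d)
    from funpow_mod_period[OF this, of "2 ^ Suc e"] show ?thesis by simp
  qed
  have "(d ^^ 2 ^ Suc e) p = (d ^^ (2 ^ Suc e mod 3)) p"
    by (rule funpow_mod_period) (simp add: numeral_3_eq_3 d)
  moreover have "2 ^ Suc e mod 3 = (1::nat) \<or> 2 ^ Suc e mod 3 = (2::nat)"
    using power_two_mod_3[of "Suc e"] by linarith
  moreover have "d (d p) \<noteq> p" using d by metis
  ultimately have dp: "(d ^^ 2 ^ Suc e) p \<noteq> p"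
    using d by (auto simp: numeral_2_eq_2)
  have "(d ^^ 2 ^ Suc e) ((c ^^ s) q) = (c ^^ s) ((d ^^ 2 ^ Suc e) q)"
    using comm by (metis comp_apply)
  then show False using cs dq dp by simp
qed


section \<open>A finite quotient of a free group separating two conjugates\<close>

text \<open>A word of minimal length among the words representing conjugates of \<open>x\<close> is cyclically
  reduced: the set of these words is closed under rotation and under cancellation.\<close>

lemma (in group) cyclically_reduced_conjugate:
  assumes pres: "has_presentation G X (\<lambda>x. x) {}" and x: "x \<in> carrier G" "x \<noteq> \<one>"
  obtains u h where "u \<in> gwords X" "u \<noteq> []" "h \<in> carrier G"
    "word_eval G (\<lambda>x. x) u = h \<otimes> x \<otimes> inv h"
    "\<And>i. i < length u \<Longrightarrow> fst (u ! i) = fst (u ! (Suc i mod length u)) \<Longrightarrow>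
      snd (u ! i) = snd (u ! (Suc i mod length u))"
proof -
  define represents where "represents u \<longleftrightarrow>
    u \<in> gwords X \<and> (\<exists>h\<in>carrier G. word_eval G (\<lambda>x. x) u = h \<otimes> x \<otimes> inv h)" for u
  have X: "(\<lambda>x. x) \<in> X \<rightarrow> carrier G" and gen: "carrier G = word_eval G (\<lambda>x. x) ` gwords X"
    using has_presentation_generates[OF is_group pres] by auto
  obtain u0 where "u0 \<in> gwords X" "word_eval G (\<lambda>x. x) u0 = x" using x gen by auto
  then have "represents u0"
    unfolding represents_def using x by (auto intro!: bexI[of _ \<one>])
  then obtain u where u: "represents u" and min: "\<And>v. represents v \<Longrightarrow> length u \<le> length v"
    using ex_has_least_nat[of represents u0 length] by blast
  have cancel: "\<not> represents (v @ [(y, b), (y, \<not> b)] @ v')"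
    if "length v + length v' + 2 = length u" for v v' y b
  proof
    assume rep: "represents (v @ [(y, b), (y, \<not> b)] @ v')"
    then have w: "v \<in> gwords X" "v' \<in> gwords X" "y \<in> X" by (auto simp: represents_def)
    then have "word_eval G (\<lambda>x. x) (v @ [(y, b), (y, \<not> b)] @ v') = word_eval G (\<lambda>x. x) (v @ v')"
      by (intro word_eval_respects_relations[OF X _ pres_rel.cancel[where R = "{}"]]) auto
    then have "represents (v @ v')" using rep w by (simp add: represents_def)
    then show False using min[of "v @ v'"] that by simp
  qed
  have rotate: "represents (l # v)" if rep: "represents (v @ [l])" for v l
  proof -
    obtain h where h: "h \<in> carrier G" "word_eval G (\<lambda>x. x) (v @ [l]) = h \<otimes> x \<otimes> inv h"
      and w: "v \<in> gwords X" "[l] \<in> gwords X"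
      using rep by (auto simp: represents_def)
    define a where "a = word_eval G (\<lambda>x. x) [l]"
    define b where "b = word_eval G (\<lambda>x. x) v"
    have c: "a \<in> carrier G" "b \<in> carrier G"
      unfolding a_def b_def using w word_eval_closed[OF X] by auto
    have "b \<otimes> a = h \<otimes> x \<otimes> inv h"
      using h w word_eval_append[OF X] by (simp add: a_def b_def)
    then have "a \<otimes> b = a \<otimes> (h \<otimes> x \<otimes> inv h) \<otimes> inv a"
      using c by (metis inv_solve_right m_assoc m_closed)
    also have "\<dots> = (a \<otimes> h) \<otimes> x \<otimes> inv (a \<otimes> h)"
      using c h x by (simp add: m_assoc inv_mult_group)
    moreover have "word_eval G (\<lambda>x. x) (l # v) = a \<otimes> b"
      using w word_eval_append[OF X, of "[l]" v] by (simp add: a_def b_def)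
    ultimately have "word_eval G (\<lambda>x. x) (l # v) = (a \<otimes> h) \<otimes> x \<otimes> inv (a \<otimes> h)"
      by simp
    then show ?thesis
      using w c h by (auto simp: represents_def intro!: bexI[of _ "a \<otimes> h"])
  qed
  have ne: "u \<noteq> []"
  proof
    assume "u = []"
    then obtain h where "h \<in> carrier G" "\<one> = h \<otimes> x \<otimes> inv h" using u by (auto simp: represents_def)
    then have "h \<otimes> \<one> = h \<otimes> x" using x(1) by (metis inv_solve_right l_one m_closed one_closed r_one)
    then have "x = \<one>" using x(1) \<open>h \<in> carrier G\<close> inv_solve_left[of x h h] by simp
    then show False using x by simp
  qed
  have reduced: "snd (u ! i) = snd (u ! (Suc i mod length u))"
    if i: "i < length u" and eq: "fst (u ! i) = fst (u ! (Suc i mod length u))" for i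
  proof (rule ccontr)
    assume ns: "snd (u ! i) \<noteq> snd (u ! (Suc i mod length u))"
    obtain y b where yb: "u ! i = (y, b)" by fastforce
    have yb': "u ! (Suc i mod length u) = (y, \<not> b)"
      using ns eq yb by (cases "u ! (Suc i mod length u)") auto
    show False
    proof (cases "Suc i < length u")
      case True
      then have "u = take i u @ [(y, b), (y, \<not> b)] @ drop (Suc (Suc i)) u"
        using yb yb' i id_take_nth_drop[OF i] by (simp add: Cons_nth_drop_Suc[symmetric])
      moreover have "length (take i u) + length (drop (Suc (Suc i)) u) + 2 = length u"
        using True by simp
      ultimately show False
        using cancel[of "take i u" "drop (Suc (Suc i)) u" y b] u by metis
    next
      case False
      then have last: "Suc i = length u" using i by simp
      then have "last u = (y, b)" using yb ne by (metis diff_Suc_1 last_conv_nth)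
      moreover have hd: "u ! 0 = (y, \<not> b)" using yb' last by simp
      ultimately have "length u \<noteq> 1" using yb last by (metis One_nat_def Suc_inject prod.inject)
      obtain z where z: "u = z @ [(y, b)]" using \<open>last u = (y, b)\<close> ne by (metis append_butlast_last_id)
      with \<open>length u \<noteq> 1\<close> obtain v where "z = (y, \<not> b) # v"
        using hd by (cases z) auto
      then have "represents ([] @ [(y, b), (y, \<not> b)] @ v)" "length v + 2 = length u"
        using rotate[of z "(y, b)"] u z by auto
      then show False using cancel[of "[]" v y b] by simp
    qed
  qed
  show thesis using that[of u] u ne reduced by (auto simp: represents_def)
qed

text \<open>The sheets of the covering are numbered by the second component, which must be below
  \<open>5\<close>; other pairs are fixed, so that a permutation of the vertices \<open>{..<m}\<close> gives
  one of the finite set \<open>{..<m} \<times> {..<5}\<close>.\<close>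

definition fibrewise :: "(nat \<Rightarrow> nat) \<Rightarrow> nat \<times> nat \<Rightarrow> nat \<times> nat" where
  "fibrewise s = (\<lambda>(i, t). if t < 5 then (s i, t) else (i, t))"

definition twist :: "(nat \<Rightarrow> nat) \<Rightarrow> nat \<times> nat \<Rightarrow> nat \<times> nat" where
  "twist v = (\<lambda>(i, t). if i = 0 then (i, v t) else (i, t))"

text \<open>A generator acts as a permutation \<open>s\<close> of the vertices, except that the edge by which the letter of sign
  \<open>e\<close> leaves vertex \<open>0\<close> permutes the sheets by \<open>v\<close>. For \<open>e = False\<close> this is the edge of the
  generator entering \<open>0\<close>, traversed backwards.\<close>

definition twisted :: "bool \<Rightarrow> (nat \<Rightarrow> nat) \<Rightarrow> (nat \<Rightarrow> nat) \<Rightarrow> nat \<times> nat \<Rightarrow> nat \<times> nat" where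
  "twisted e v s = (if e then fibrewise s \<circ> twist v else twist (inv_into UNIV v) \<circ> fibrewise s)"

definition signed_perm :: "('a \<Rightarrow> 'a) \<Rightarrow> bool \<Rightarrow> 'a \<Rightarrow> 'a" where
  "signed_perm p e = (if e then p else inv_into UNIV p)"

lemma permutes_by_inverse:
  assumes "\<And>x. x \<notin> S \<Longrightarrow> f x = x" "\<And>x. g (f x) = x" "\<And>x. f (g x) = x"
  shows "f permutes S" "inv_into UNIV f = g"
proof -
  show "f permutes S" unfolding permutes_def using assms by metis
  show "inv_into UNIV f = g" using assms by (metis inv_unique_comp comp_apply eq_id_iff)
qed

lemma fibrewise_permutes:
  assumes s: "s permutes {..<m}"
  shows "fibrewise s permutes {..<m} \<times> {..<5}" "inv_into UNIV (fibrewise s) = fibrewise (inv_into UNIV s)"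
proof -
  have out: "x < m" if "s x \<noteq> x" for x using that permutes_not_in[OF s] by blast
  show "fibrewise s permutes {..<m} \<times> {..<5}" "inv_into UNIV (fibrewise s) = fibrewise (inv_into UNIV s)"
    by (rule permutes_by_inverse[where g = "fibrewise (inv_into UNIV s)"];
        use permutes_inverses[OF s] out in \<open>auto simp: fibrewise_def split: if_splits\<close>)+
qed

lemma twist_permutes:
  assumes v: "v permutes {..<5}" and m: "0 < m"
  shows "twist v permutes {..<m} \<times> {..<5}" "inv_into UNIV (twist v) = twist (inv_into UNIV v)"
proof -
  have out: "x < 5" if "v x \<noteq> x" for x using that permutes_not_in[OF v] by blast
  show "twist v permutes {..<m} \<times> {..<5}" "inv_into UNIV (twist v) = twist (inv_into UNIV v)"
    by (rule permutes_by_inverse[where g = "twist (inv_into UNIV v)"];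
        use permutes_inverses[OF v] out m in \<open>auto simp: twist_def split: if_splits\<close>)+
qed

lemma twisted_permutes:
  assumes s: "s permutes {..<m}" and v: "v permutes {..<5}" and m: "0 < m"
  shows "twisted e v s permutes {..<m} \<times> {..<5}"
  using fibrewise_permutes(1)[OF s] twist_permutes(1)[OF v m]
    twist_permutes(1)[OF permutes_inv[OF v] m]
  by (auto simp: twisted_def intro: permutes_compose)

lemma signed_twisted_apply:
  assumes s: "s permutes {..<m}" and v: "v permutes {..<5}" and m: "0 < m"
    and t: "t < 5"
  shows "signed_perm (twisted e v s) e' (i, t) =
    (signed_perm s e' i,
     if e' = e then (if i = 0 then v t else t)
     else (if signed_perm s e' i = 0 then inv_into UNIV v t else t))"
proof -
  have fib: "bij (fibrewise s)" using fibrewise_permutes(1)[OF s] by (rule permutes_bij)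
  have tw: "bij (twist v)" "bij (twist (inv_into UNIV v))"
    using twist_permutes(1)[OF v m] twist_permutes(1)[OF permutes_inv[OF v] m]
    by (simp_all add: permutes_bij)
  have inv_tw: "inv_into UNIV (twisted e v s) =
      (if e then twist (inv_into UNIV v) \<circ> fibrewise (inv_into UNIV s) else fibrewise (inv_into UNIV s) \<circ> twist v)" for e
    using fib tw fibrewise_permutes(2)[OF s] twist_permutes(2)[OF v m]
      twist_permutes(2)[OF permutes_inv[OF v] m] permutes_inv_inv[OF v]
    by (simp add: twisted_def o_inv_distrib)
  have vt: "v t < 5" using permutes_in_image[OF v] t by (metis lessThan_iff)
  show ?thesis
    using t vt
    by (cases e; cases e'; simp add: signed_perm_def inv_tw)
      (auto simp: twisted_def fibrewise_def twist_def)
qed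

lemma word_eval_perm_group_Cons:
  assumes "p (fst l) permutes S"
  shows "word_eval (perm_group S) p (l # u) = signed_perm (p (fst l)) (snd l) \<circ> word_eval (perm_group S) p u"
  using assms by (cases l) (simp add: signed_perm_def inv_perm_group)


text \<open>Vertex \<open>i < m\<close> of the cycle is the position between two letters of a cyclically reduced word
  \<open>u\<close> of length \<open>m\<close> for a conjugate \<open>x0\<close> of \<open>x\<close>, numbered such that letter \<open>i\<close> leads from
  \<open>i + 1\<close> modulo \<open>m\<close> to \<open>i\<close>, because permutations act from the left. The edge by which \<open>x0\<close>
  leaves vertex \<open>0\<close> carries the twist \<open>\<pi>\<close>. A second edge leaving \<open>0\<close>, labelled by another generator and
  not part of the cycle, carries \<open>\<kappa>\<close>; it exists because \<open>0\<close> meets only two edges of the cycle.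
  Following that generator until it first returns to \<open>0\<close> gives a loop \<open>f\<close> with twist \<open>\<kappa>\<close>, and
  \<open>f x0 f\<inverse>\<close> is the conjugate to be compared with \<open>x0\<close>.\<close>

lemma free_group_separates_conjugates:
  fixes G :: "('a, 'b) monoid_scheme"
  assumes G: "group G" and pres: "has_presentation G X (\<lambda>x. x) {}"
    and a: "a1 \<in> X" "a2 \<in> X" "a1 \<noteq> a2"
    and x: "x \<in> carrier G" "x \<noteq> \<one>\<^bsub>G\<^esub>"
  obtains Q :: "(nat \<times> nat \<Rightarrow> nat \<times> nat) monoid" and \<theta> h h'
  where "group Q" "finite (carrier Q)" "\<theta> \<in> hom G Q" "h \<in> carrier G" "h' \<in> carrier G"
    "separated_pair Q (\<theta> (h \<otimes>\<^bsub>G\<^esub> x \<otimes>\<^bsub>G\<^esub> inv\<^bsub>G\<^esub> h)) (\<theta> (h' \<otimes>\<^bsub>G\<^esub> x \<otimes>\<^bsub>G\<^esub> inv\<^bsub>G\<^esub> h'))"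
proof -
  interpret G: group G by fact
  have X: "(\<lambda>x. x) \<in> X \<rightarrow> carrier G"
    using has_presentation_generates[OF G pres] by auto
  obtain u h where u: "u \<in> gwords X" "u \<noteq> []" and h: "h \<in> carrier G"
    and eval_u: "word_eval G (\<lambda>x. x) u = h \<otimes>\<^bsub>G\<^esub> x \<otimes>\<^bsub>G\<^esub> inv\<^bsub>G\<^esub> h"
    and reduced: "\<And>i. i < length u \<Longrightarrow> fst (u ! i) = fst (u ! (Suc i mod length u)) \<Longrightarrow>
      snd (u ! i) = snd (u ! (Suc i mod length u))"
    using G.cyclically_reduced_conjugate[OF pres x] by blast
  define m where "m = length u"
  have m: "0 < m" using u by (simp add: m_def)

  \<comment> \<open>The edges of the cycle with label \<open>g\<close>. Cyclic reducedness says exactly that they form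
    a partial injection.\<close>
  define step where "step g = {(Suc i mod m, i) | i. i < m \<and> u ! i = (g, True)} \<union>
    {(i, Suc i mod m) | i. i < m \<and> u ! i = (g, False)}" for g
  have suc_inj: "i = j" if "Suc i mod m = Suc j mod m" "i < m" "j < m" for i j
    using that by (auto simp: mod_Suc split: if_splits)
  have clash: "u ! i = (g, b) \<Longrightarrow> u ! (Suc i mod m) \<noteq> (g, \<not> b)" if "i < m" for i g b
    using reduced[of i] that unfolding m_def by (metis fst_conv snd_conv)
  have clashT: "u ! (Suc i mod m) \<noteq> (g, False)" if "i < m" "u ! i = (g, True)" for i g
    using clash[OF that] by simp
  have clashF: "u ! (Suc i mod m) \<noteq> (g, True)" if "i < m" "u ! i = (g, False)" for i g
    using clash[OF that] by simp
  have step_iff: "(i, j) \<in> step g \<longleftrightarrow> j < m \<and> u ! j = (g, True) \<and> i = Suc j mod m \<or>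
      i < m \<and> u ! i = (g, False) \<and> j = Suc i mod m" for i j g
    by (auto simp: step_def)
  have "\<exists>s. s permutes {..<m} \<and> (\<forall>i j. (i, j) \<in> step g \<longrightarrow> s i = j)" for g
  proof -
    have sub: "step g \<subseteq> {..<m} \<times> {..<m}" using m by (auto simp: step_def)
    have "j = j'" if "(i, j) \<in> step g" "(i, j') \<in> step g" for i j j'
      using that unfolding step_iff by (elim disjE conjE) (metis suc_inj clashT)+
    moreover have "i = i'" if "(i, j) \<in> step g" "(i', j) \<in> step g" for i i' j
      using that unfolding step_iff by (elim disjE conjE) (metis suc_inj clashF)+
    ultimately obtain s where "s permutes {..<m}" "\<And>i j. (i, j) \<in> step g \<Longrightarrow> s i = j"
      using extend_partial_injection[OF finite_lessThan sub] by blast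
    then show ?thesis by blast
  qed
  define \<sigma> where "\<sigma> g = (SOME s. s permutes {..<m} \<and> (\<forall>i j. (i, j) \<in> step g \<longrightarrow> s i = j))" for g
  have \<sigma>: "\<sigma> g permutes {..<m}" and \<sigma>_step: "(i, j) \<in> step g \<Longrightarrow> \<sigma> g i = j" for g i j
    using someI_ex[OF \<open>\<exists>s. s permutes {..<m} \<and> (\<forall>i j. (i, j) \<in> step g \<longrightarrow> s i = j)\<close>]
    unfolding \<sigma>_def[symmetric] by blast+
  have along: "signed_perm (\<sigma> (fst (u ! i))) (snd (u ! i)) (Suc i mod m) = i" if i: "i < m" for i
  proof (cases "snd (u ! i)")
    case True
    then have "(Suc i mod m, i) \<in> step (fst (u ! i))"
      using i by (cases "u ! i") (auto simp: step_def)
    then show ?thesis using \<sigma>_step True by (simp add: signed_perm_def)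
  next
    case False
    then have "(i, Suc i mod m) \<in> step (fst (u ! i))"
      using i by (cases "u ! i") (auto simp: step_def)
    then have "\<sigma> (fst (u ! i)) i = Suc i mod m" by (rule \<sigma>_step)
    then show ?thesis using False permutes_inverses(2)[OF \<sigma>] by (metis signed_perm_def)
  qed

  \<comment> \<open>\<open>L\<close> is the letter of \<open>u\<close> that acts first, hence the one leaving vertex \<open>0\<close>. The sign \<open>\<epsilon>\<close> keeps
    \<open>(\<beta>, \<epsilon>)\<close> different from the inverse of \<open>u ! 0\<close>, the other edge of the cycle at \<open>0\<close>.\<close>
  define L where "L = u ! (m - 1)"
  define \<beta> where "\<beta> = (if fst L = a1 then a2 else a1)"
  have \<beta>: "\<beta> \<in> X" "\<beta> \<noteq> fst L" using a by (auto simp: \<beta>_def)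
  define \<epsilon> where "\<epsilon> = (if fst (u ! 0) = \<beta> then snd (u ! 0) else True)"
  define \<pi> :: "nat \<Rightarrow> nat" where "\<pi> = transpose 0 1 \<circ> (transpose 2 3 \<circ> transpose 3 4)"
  define \<kappa> :: "nat \<Rightarrow> nat" where "\<kappa> = transpose 0 2"
  have \<kappa>: "\<kappa> permutes {..<5}" "inv_into UNIV \<kappa> = \<kappa>"
    unfolding \<kappa>_def by (simp_all add: permutes_swap_id)
  have \<pi>: "\<pi> permutes {..<5}" unfolding \<pi>_def by (intro permutes_compose permutes_swap_id) auto
  define sg where "sg g = (if g = fst L then snd L else if g = \<beta> then \<epsilon> else True)" for g
  define vo where "vo g = (if g = fst L then \<pi> else if g = \<beta> then \<kappa> else id)" for g
  have vo: "vo g permutes {..<5}" for g using \<pi> \<kappa> by (simp add: vo_def permutes_id)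
  define P where "P g = twisted (sg g) (vo g) (\<sigma> g)" for g
  define S where "S = {..<m} \<times> {..<5::nat}"
  define Q where "Q = perm_group S"
  have P: "P g permutes S" for g unfolding P_def S_def by (rule twisted_permutes[OF \<sigma> vo m])
  have apply_letter: "signed_perm (P g) e (i, t) = (signed_perm (\<sigma> g) e i,
     if e = sg g then (if i = 0 then vo g t else t)
     else (if signed_perm (\<sigma> g) e i = 0 then inv_into UNIV (vo g) t else t))" if "t < 5" for g e i t
    unfolding P_def by (rule signed_twisted_apply[OF \<sigma> vo m that])
  interpret Q: group Q unfolding Q_def by (rule group_perm_group)
  have fin: "finite (carrier Q)" unfolding Q_def S_def by (intro finite_perm_group) auto
  have PX: "P \<in> X \<rightarrow> carrier Q" using P by (auto simp: Q_def)
  obtain \<theta> where \<theta>: "\<theta> \<in> hom G Q"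
    and \<theta>_eval: "\<And>v. v \<in> gwords X \<Longrightarrow> \<theta> (word_eval G (\<lambda>x. x) v) = word_eval Q P v"
    by (rule has_presentation_lift[OF G pres Q.is_group PX]) (simp, blast)
  interpret \<theta>: group_hom G Q \<theta> using \<theta> by unfold_locales
  have eval_Cons: "word_eval Q P (l # v) y = signed_perm (P (fst l)) (snd l) (word_eval Q P v y)" for l v y
    unfolding Q_def by (simp add: word_eval_perm_group_Cons[OF P])

  have eval_Nil: "word_eval Q P [] y = y" for y by (simp add: Q_def)

  have around: "word_eval Q P (drop j u) (0, t) = (j, \<pi> t)" if "j \<le> m - 1" "t < 5" for j t
    using that(1)
  proof (induction j rule: inc_induct)
    case base
    have "drop (m - 1) u = [L]"
      using Cons_nth_drop_Suc[of "m - 1" u] m by (simp add: L_def m_def)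
    moreover have "signed_perm (\<sigma> (fst L)) (snd L) 0 = m - 1"
      using along[of "m - 1"] m by (simp add: L_def)
    ultimately show ?case
      using that(2) by (simp add: eval_Cons apply_letter sg_def vo_def eval_Nil del: word_eval.simps)
  next
    case (step j)
    define l where "l = u ! j"
    have j: "Suc j mod m = Suc j" "j < m" using step by auto
    have "drop j u = l # drop (Suc j) u" using j by (simp add: l_def m_def Cons_nth_drop_Suc)
    then have "word_eval Q P (drop j u) (0, t) = signed_perm (P (fst l)) (snd l) (Suc j, \<pi> t)"
      using step.IH by (simp add: eval_Cons)
    moreover have "signed_perm (\<sigma> (fst l)) (snd l) (Suc j) = j"
      using along[OF j(2)] j by (simp add: l_def)
    moreover have "\<pi> t < 5" using permutes_in_image[OF \<pi>, of t] that(2) by simp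
    \<comment> \<open>Going from \<open>Suc j \<noteq> 0\<close> to \<open>j\<close>, a twist could only be met backwards and at \<open>j = 0\<close>; both
      twisted edges at \<open>0\<close> differ from the last edge of the cycle.\<close>
    moreover have "vo (fst l) = id" if "j = 0" "snd l \<noteq> sg (fst l)"
    proof -
      have l0: "l = u ! 0" using that(1) by (simp add: l_def)
      have "fst l \<noteq> fst L"
      proof
        assume eq: "fst l = fst L"
        have "Suc (m - 1) mod m = 0" using m by simp
        then have "snd L = snd l"
          using reduced[of "m - 1"] eq m by (simp add: L_def l0 m_def)
        then show False using that(2) eq by (simp add: sg_def)
      qed
      moreover have "fst l \<noteq> \<beta>"
        using that(2) \<beta>(2) l0 by (auto simp: sg_def \<epsilon>_def)
      ultimately show ?thesis by (simp add: vo_def)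
    qed
    ultimately show ?case by (auto simp: apply_letter)
  qed

  define b where "b = (\<beta>, \<epsilon>)"
  define \<tau> where "\<tau> = signed_perm (\<sigma> \<beta>) \<epsilon>"
  have \<tau>: "\<tau> permutes {..<m}" using \<sigma> by (simp add: \<tau>_def signed_perm_def permutes_inv)
  have "\<exists>n. 0 < n \<and> (\<tau> ^^ n) 0 = 0"
  proof -
    interpret T: group "perm_group {..<m}" by (rule group_perm_group)
    have "\<tau> [^]\<^bsub>perm_group {..<m}\<^esub> order (perm_group {..<m}) = id"
      using T.pow_order_eq_1[of \<tau>] \<tau> by simp
    moreover have "0 < order (perm_group {..<m})"
      using finite_perm_group[of "{..<m}"] by (simp add: T.order_gt_0_iff_finite)
    ultimately show ?thesis by (metis pow_perm_group id_apply)
  qed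
  \<comment> \<open>The first return matters: a later one would pick up \<open>\<kappa>\<close> several times.\<close>
  then obtain n where n: "0 < n" "(\<tau> ^^ n) 0 = 0" and n_min: "\<And>k. 0 < k \<Longrightarrow> k < n \<Longrightarrow> (\<tau> ^^ k) 0 \<noteq> 0"
    using exists_least_iff[of "\<lambda>n. 0 < n \<and> (\<tau> ^^ n) 0 = 0"] by metis
  define f where "f = word_eval G (\<lambda>x. x) (replicate n b)"
  have rep: "replicate k b \<in> gwords X" for k
    using \<beta>(1) by (auto simp: b_def gwords_def lists_eq_set)
  have loop: "word_eval Q P (replicate (Suc k) b) (0, t) = ((\<tau> ^^ Suc k) 0, \<kappa> t)"
    if "k < n" "t < 5" for k t
    using that(1)
  proof (induction k)
    case 0
    then show ?case
      using \<beta>(2) that(2)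
      by (simp add: eval_Cons apply_letter sg_def vo_def b_def \<tau>_def eval_Nil del: word_eval.simps)
  next
    case (Suc k)
    have \<kappa>t: "\<kappa> t < 5" using permutes_in_image[OF \<kappa>(1), of t] that(2) by simp
    have "word_eval Q P (replicate (Suc (Suc k)) b) (0, t)
        = signed_perm (P \<beta>) \<epsilon> (word_eval Q P (replicate (Suc k) b) (0, t))"
      by (subst replicate_Suc) (simp only: eval_Cons b_def fst_conv snd_conv)
    also have "\<dots> = signed_perm (P \<beta>) \<epsilon> ((\<tau> ^^ Suc k) 0, \<kappa> t)"
      using Suc by simp
    also have "\<dots> = ((\<tau> ^^ Suc (Suc k)) 0, \<kappa> t)"
      using n_min[of "Suc k"] Suc.prems \<beta>(2) by (simp add: apply_letter[OF \<kappa>t] sg_def \<tau>_def)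
    finally show ?case .
  qed
  have f: "f \<in> carrier G" unfolding f_def using rep G.word_eval_closed[OF X] by blast
  have \<theta>f: "\<theta> f (0, t) = (0, \<kappa> t)" if "t < 5" for t
    unfolding f_def using loop[of "n - 1" t] n that \<theta>_eval[OF rep] by simp

  define x0 where "x0 = h \<otimes>\<^bsub>G\<^esub> x \<otimes>\<^bsub>G\<^esub> inv\<^bsub>G\<^esub> h"
  have x0: "x0 \<in> carrier G" using x h by (simp add: x0_def)
  have \<theta>x0: "\<theta> x0 (0, t) = (0, \<pi> t)" if "t < 5" for t
    using around[of 0 t] that \<theta>_eval[OF u(1)] eval_u by (simp add: x0_def)
  define y where "y = f \<otimes>\<^bsub>G\<^esub> x0 \<otimes>\<^bsub>G\<^esub> inv\<^bsub>G\<^esub> f"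
  have y: "y = (f \<otimes>\<^bsub>G\<^esub> h) \<otimes>\<^bsub>G\<^esub> x \<otimes>\<^bsub>G\<^esub> inv\<^bsub>G\<^esub> (f \<otimes>\<^bsub>G\<^esub> h)"
    using x h f by (simp add: y_def x0_def G.m_assoc G.inv_mult_group)
  have \<theta>y: "\<theta> y (0, t) = (0, \<kappa> (\<pi> (\<kappa> t)))" if t: "t < 5" for t
  proof -
    have perm: "\<theta> f permutes S" using \<theta>.hom_closed[OF f] by (simp add: Q_def)
    have lt: "\<kappa> t < 5" "\<pi> (\<kappa> t) < 5"
      using permutes_in_image[OF \<kappa>(1)] permutes_in_image[OF \<pi>] t by (metis lessThan_iff)+
    have "\<kappa> (\<kappa> t) = t" by (simp add: \<kappa>_def)
    then have "\<theta> f (0, \<kappa> t) = (0, t)" using \<theta>f[OF lt(1)] by simp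
    then have "inv_into UNIV (\<theta> f) (0, t) = (0, \<kappa> t)"
      using permutes_inverses(2)[OF perm] by metis
    moreover have "\<theta> y = \<theta> f \<circ> \<theta> x0 \<circ> inv_into UNIV (\<theta> f)"
      using f x0 inv_perm_group[OF perm] by (simp add: y_def) (simp add: Q_def)
    ultimately show ?thesis using \<theta>x0[OF lt(1)] \<theta>f[OF lt(2)] by simp
  qed
  have x_cycles: "\<theta> x0 (0, 0) = (0, 1)" "\<theta> x0 (0, 1) = (0, 0)"
    by (simp_all add: \<theta>x0 \<pi>_def transpose_def)
  have y_cycles: "\<theta> y (0, 0) = (0, 3)" "\<theta> y (0, 3) = (0, 4)" "\<theta> y (0, 4) = (0, 0)"
    "\<theta> y (0, 1) = (0, 2)" "\<theta> y (0, 2) = (0, 1)"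
    by (simp_all add: \<theta>y \<pi>_def \<kappa>_def transpose_def)
  have "separated_pair Q (\<theta> x0) (\<theta> y)"
    unfolding Q_def
    by (rule separated_pair_perm_group[OF x_cycles]) (simp_all only: y_cycles, simp)
  then show thesis
    using that[OF Q.is_group fin \<theta> h, of "f \<otimes>\<^bsub>G\<^esub> h"] f h y by (simp add: x0_def)
qed

section \<open>Integral reflection matrices\<close>

abbreviation int_gl :: "nat \<Rightarrow> int mat monoid" where
  "int_gl r \<equiv> units_of (ring_mat TYPE(int) r ())"

lemma group_units_ring_mat: "group (units_of (ring_mat TYPE('a :: comm_ring_1) r ()))"
  by (rule monoid.units_group) (rule ring.is_monoid[OF ring_mat])

lemma units_ring_mat_simps:
  "A \<otimes>\<^bsub>units_of (ring_mat TYPE('a :: comm_ring_1) r ())\<^esub> B = A * B"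
  "\<one>\<^bsub>units_of (ring_mat TYPE('a) r ())\<^esub> = 1\<^sub>m r"
  "A \<in> carrier (units_of (ring_mat TYPE('a) r ())) \<longleftrightarrow>
    A \<in> carrier_mat r r \<and> (\<exists>B\<in>carrier_mat r r. B * A = 1\<^sub>m r \<and> A * B = 1\<^sub>m r)"
  by (simp_all add: units_of_mult units_of_one units_of_carrier Units_def ring_mat_simps)

lemma mult_mat_unit_vec:
  fixes A :: "'a :: semiring_1 mat"
  assumes "A \<in> carrier_mat n n" "i < n" "j < n"
  shows "(A *\<^sub>v unit_vec n j) $ i = A $$ (i, j)"
  using assms by simp

lemma mult_mat_vec_smult:
  fixes A :: "'a :: comm_semiring_1 mat"
  assumes "A \<in> carrier_mat n k" "v \<in> carrier_vec k"
  shows "A *\<^sub>v (a \<cdot>\<^sub>v v) = a \<cdot>\<^sub>v (A *\<^sub>v v)"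
  using assms by (intro eq_vecI) (auto simp: scalar_prod_def sum_distrib_left ac_simps)

lemma mat_eq_by_action:
  fixes A B :: "'a :: semiring_1 mat"
  assumes "A \<in> carrier_mat n n" "B \<in> carrier_mat n n"
    and "\<And>v. v \<in> carrier_vec n \<Longrightarrow> A *\<^sub>v v = B *\<^sub>v v"
  shows "A = B"
proof (rule eq_matI)
  fix i j assume "i < dim_row B" "j < dim_col B"
  then have ij: "i < n" "j < n" using assms by auto
  show "A $$ (i, j) = B $$ (i, j)"
    using mult_mat_unit_vec[OF assms(1) ij] mult_mat_unit_vec[OF assms(2) ij] assms(3)[of "unit_vec n j"]
    by simp
qed (use assms in auto)

text \<open>The entries are twice the values of the Tits form on the simple roots, which are integers for
  a small system.\<close>

locale cartan_matrix =
  fixes r :: nat and c :: "nat \<Rightarrow> nat \<Rightarrow> int"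
  assumes c_diag: "i < r \<Longrightarrow> c i i = 2"
    and c_sym: "i < r \<Longrightarrow> j < r \<Longrightarrow> c i j = c j i"
begin

definition pairing :: "nat \<Rightarrow> int vec \<Rightarrow> int" where
  "pairing i v = (\<Sum>j<r. c i j * v $ j)"

definition form :: "int vec \<Rightarrow> int vec \<Rightarrow> int" where
  "form u v = (\<Sum>i<r. u $ i * pairing i v)"

definition reflection :: "nat \<Rightarrow> int mat" where
  "reflection i = mat r r (\<lambda>(a, b). (if a = b then 1 else 0) - (if a = i then c i b else 0))"

lemma reflection_carrier [simp]: "reflection i \<in> carrier_mat r r"
  by (simp add: reflection_def)

lemma reflection_apply:
  assumes v: "v \<in> carrier_vec r" and i: "i < r"
  shows "reflection i *\<^sub>v v = v - pairing i v \<cdot>\<^sub>v unit_vec r i"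
proof (rule eq_vecI)
  fix a assume "a < dim_vec (v - pairing i v \<cdot>\<^sub>v unit_vec r i)"
  then have a: "a < r" by simp
  have "(reflection i *\<^sub>v v) $ a = (\<Sum>b<r. ((if a = b then 1 else 0) - (if a = i then c i b else 0)) * v $ b)"
    using a v by (simp add: reflection_def scalar_prod_def atLeast0LessThan)
  also have "\<dots> = (\<Sum>b<r. if a = b then v $ b else 0) - (if a = i then pairing i v else 0)"
    by (simp add: left_diff_distrib sum_subtractf pairing_def if_distrib[of "\<lambda>x. x * _"] cong: if_cong)
  finally show "(reflection i *\<^sub>v v) $ a = (v - pairing i v \<cdot>\<^sub>v unit_vec r i) $ a"
    using a i v by simp
qed (use v in \<open>simp add: reflection_def\<close>)

lemma pairing_diff:
  assumes "u \<in> carrier_vec r" "v \<in> carrier_vec r"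
  shows "pairing i (u - k \<cdot>\<^sub>v v) = pairing i u - k * pairing i v"
  using assms by (simp add: pairing_def sum_subtractf sum_distrib_left algebra_simps)

lemma pairing_unit [simp]: "j < r \<Longrightarrow> pairing i (unit_vec r j) = c i j"
  by (simp add: pairing_def if_distrib[of "\<lambda>x. _ * x"] cong: if_cong)

lemma form_unit [simp]: "i < r \<Longrightarrow> form (unit_vec r i) v = pairing i v"
  by (simp add: form_def if_distrib[of "\<lambda>x. x * _"] cong: if_cong)

lemma form_sym: "form u v = form v u"
proof -
  have "form u v = (\<Sum>i<r. \<Sum>j<r. u $ i * c i j * v $ j)"
    by (simp add: form_def pairing_def sum_distrib_left mult.assoc)
  also have "\<dots> = (\<Sum>j<r. \<Sum>i<r. u $ i * c i j * v $ j)" by (rule sum.swap)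
  also have "\<dots> = (\<Sum>j<r. \<Sum>i<r. v $ j * (c j i * u $ i))"
    by (intro sum.cong HOL.refl) (auto simp: c_sym ac_simps)
  also have "\<dots> = form v u"
    by (simp add: form_def pairing_def sum_distrib_left)
  finally show ?thesis .
qed

lemma form_diff:
  assumes "u \<in> carrier_vec r" "v \<in> carrier_vec r"
  shows "form z (u - k \<cdot>\<^sub>v v) = form z u - k * form z v"
    and "form (u - k \<cdot>\<^sub>v v) z = form u z - k * form v z"
proof -
  show "form z (u - k \<cdot>\<^sub>v v) = form z u - k * form z v"
    using assms by (simp add: form_def pairing_diff sum_subtractf sum_distrib_left algebra_simps)
  then show "form (u - k \<cdot>\<^sub>v v) z = form u z - k * form v z"
    using form_sym by simp
qed

lemma reflection_preserves_form:
  assumes "u \<in> carrier_vec r" "v \<in> carrier_vec r" "i < r"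
  shows "form (reflection i *\<^sub>v u) (reflection i *\<^sub>v v) = form u v"
  using assms form_sym[of u "unit_vec r i"]
  by (simp add: reflection_apply form_diff pairing_diff c_diag algebra_simps)

lemma reflection_involution:
  assumes i: "i < r"
  shows "reflection i * reflection i = 1\<^sub>m r"
proof (rule mat_eq_by_action)
  fix v :: "int vec" assume v: "v \<in> carrier_vec r"
  have "reflection i * reflection i *\<^sub>v v = reflection i *\<^sub>v (reflection i *\<^sub>v v)"
    using v by (intro assoc_mult_mat_vec[of _ r r _ r]) auto
  also have "\<dots> = v" using v i
    by (intro eq_vecI) (auto simp: reflection_apply pairing_diff c_diag algebra_simps)
  finally show "reflection i * reflection i *\<^sub>v v = 1\<^sub>m r *\<^sub>v v" using v by simp
qed (auto intro: mult_carrier_mat[of _ r r])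

lemma reflection_commute:
  assumes ij: "i < r" "j < r" "c i j = 0"
  shows "reflection i * reflection j = reflection j * reflection i"
proof (rule mat_eq_by_action)
  fix v :: "int vec" assume v: "v \<in> carrier_vec r"
  have *: "c j i = 0" using ij c_sym by simp
  have "reflection i * reflection j *\<^sub>v v = reflection i *\<^sub>v (reflection j *\<^sub>v v)" "reflection j * reflection i *\<^sub>v v = reflection j *\<^sub>v (reflection i *\<^sub>v v)"
    using v by (intro assoc_mult_mat_vec[of _ r r _ r]; auto)+
  then show "reflection i * reflection j *\<^sub>v v = reflection j * reflection i *\<^sub>v v" using v ij *
    by (auto simp: reflection_apply pairing_diff c_diag algebra_simps)
qed (auto intro: mult_carrier_mat[of _ r r])

lemma reflection_braid:
  assumes ij: "i < r" "j < r" "c i j = -1"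
  shows "reflection i * (reflection j * reflection i) = reflection j * (reflection i * reflection j)"
proof (rule mat_eq_by_action)
  fix v :: "int vec" assume v: "v \<in> carrier_vec r"
  have *: "c j i = -1" using ij c_sym by simp
  have expand: "reflection a * (reflection b * reflection a) *\<^sub>v v = reflection a *\<^sub>v (reflection b *\<^sub>v (reflection a *\<^sub>v v))" for a b
    using v by (subst assoc_mult_mat_vec[of _ r r _ r]; (auto intro: mult_carrier_mat[of _ r r])?)+
  show "reflection i * (reflection j * reflection i) *\<^sub>v v = reflection j * (reflection i * reflection j) *\<^sub>v v"
    unfolding expand using v ij *
    by (intro eq_vecI) (auto simp: reflection_apply pairing_diff c_diag algebra_simps)
qed (auto intro!: mult_carrier_mat[of _ r r])

lemma reflection_in_int_gl: "i < r \<Longrightarrow> reflection i \<in> carrier (int_gl r)"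
  using reflection_involution[of i] by (auto simp: units_ring_mat_simps intro!: bexI[of _ "reflection i"])

lemma reflection_inverse: "i < r \<Longrightarrow> inv\<^bsub>int_gl r\<^esub> reflection i = reflection i"
  by (rule group.inv_equality[OF group_units_ring_mat])
    (simp_all add: reflection_involution reflection_in_int_gl units_ring_mat_simps(1,2))

end

section \<open>Congruences of integer matrices\<close>

definition mat_cong :: "nat \<Rightarrow> nat \<Rightarrow> int mat \<Rightarrow> int mat \<Rightarrow> bool" where
  "mat_cong r k A B \<longleftrightarrow> (\<forall>i<r. \<forall>j<r. [A $$ (i, j) = B $$ (i, j)] (mod int k))"

lemma mat_cong_refl [simp]: "mat_cong r k A A"
  by (simp add: mat_cong_def)

lemma mat_cong_trans: "mat_cong r k A B \<Longrightarrow> mat_cong r k B C \<Longrightarrow> mat_cong r k A C"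
  unfolding mat_cong_def using Cong.cong_trans by blast

lemma mat_cong_sym: "mat_cong r k A B \<Longrightarrow> mat_cong r k B A"
  unfolding mat_cong_def using Cong.cong_sym by blast

lemma mat_cong_mult:
  assumes "mat_cong r k A A'" "mat_cong r k B B'"
    and "A \<in> carrier_mat r r" "A' \<in> carrier_mat r r" "B \<in> carrier_mat r r" "B' \<in> carrier_mat r r"
  shows "mat_cong r k (A * B) (A' * B')"
  unfolding mat_cong_def
proof (intro allI impI)
  fix i j assume ij: "i < r" "j < r"
  have "[(\<Sum>l<r. A $$ (i, l) * B $$ (l, j)) = (\<Sum>l<r. A' $$ (i, l) * B' $$ (l, j))] (mod int k)"
    using assms(1,2) ij by (intro cong_sum cong_mult) (auto simp: mat_cong_def)
  then show "[(A * B) $$ (i, j) = (A' * B') $$ (i, j)] (mod int k)"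
    using ij assms(3-) by (simp add: scalar_prod_def atLeast0LessThan)
qed

lemma mat_cong_coprime:
  assumes "mat_cong r k A B" "mat_cong r l A B" "coprime k l"
  shows "mat_cong r (k * l) A B"
  using assms by (auto simp: mat_cong_def intro: coprime_cong_mult)


section \<open>Groups generated by reflections, and their congruence subgroups\<close>

lemma (in group) pow_conj:
  assumes "x \<in> carrier G" "h \<in> carrier G"
  shows "(h \<otimes> x \<otimes> inv h) [^] (k::nat) = h \<otimes> x [^] k \<otimes> inv h"
proof (induction k)
  case (Suc k)
  have cancel: "inv h \<otimes> (h \<otimes> z) = z" if "z \<in> carrier G" for z
    using assms that by (simp add: m_assoc[symmetric])
  have "(h \<otimes> x [^] k \<otimes> inv h) \<otimes> (h \<otimes> x \<otimes> inv h) = h \<otimes> (x [^] k \<otimes> x) \<otimes> inv h"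
    using assms cancel by (simp add: m_assoc)
  then show ?case using Suc by simp
qed (use assms in simp)

text \<open>A group generated by \<open>w 0, \<dots>, w (r - 1)\<close> with an integral representation sending generators
  to reflections. Coxeter groups and triplet groups are treated alike through this interface,
  whichever presentation they are given by.\<close>

locale reflection_representation = cartan_matrix r c + group W
  for r :: nat and c :: "nat \<Rightarrow> nat \<Rightarrow> int" and W :: "('a, 'b) monoid_scheme" (structure) +
  fixes w :: "nat \<Rightarrow> 'a" and \<rho> :: "'a \<Rightarrow> int mat"
  assumes w_closed: "w \<in> {..<r} \<rightarrow> carrier W"
    and w_generates: "carrier W = word_eval W w ` gwords {..<r}"
    and rho_hom: "\<rho> \<in> hom W (int_gl r)"
    and rho_w: "i < r \<Longrightarrow> \<rho> (w i) = reflection i"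
begin

sublocale rho: group_hom W "int_gl r" \<rho>
  using rho_hom group_units_ring_mat
  by (simp add: group_hom_def group_hom_axioms_def is_group)

declare rho.hom_mult [simp del] rho.hom_one [simp del] rho.hom_inv [simp del]

lemma rho_mult: "g \<in> carrier W \<Longrightarrow> h \<in> carrier W \<Longrightarrow> \<rho> (g \<otimes> h) = \<rho> g * \<rho> h"
  using rho.hom_mult by (simp add: units_ring_mat_simps(1))

lemma rho_one: "\<rho> \<one> = 1\<^sub>m r"
  using rho.hom_one by (simp add: units_ring_mat_simps(2))

lemma rho_carrier: "g \<in> carrier W \<Longrightarrow> \<rho> g \<in> carrier_mat r r"
  using rho.hom_closed[of g] by (simp add: units_ring_mat_simps(3))

lemma rho_vec: "g \<in> carrier W \<Longrightarrow> v \<in> carrier_vec r \<Longrightarrow> \<rho> g *\<^sub>v v \<in> carrier_vec r"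
  by (rule mult_mat_vec_carrier[OF rho_carrier])

lemma rho_mult_vec:
  "g \<in> carrier W \<Longrightarrow> h \<in> carrier W \<Longrightarrow> v \<in> carrier_vec r \<Longrightarrow>
    \<rho> (g \<otimes> h) *\<^sub>v v = \<rho> g *\<^sub>v (\<rho> h *\<^sub>v v)"
  using assoc_mult_mat_vec[OF rho_carrier rho_carrier] by (simp add: rho_mult)

lemma rho_one_vec: "v \<in> carrier_vec r \<Longrightarrow> \<rho> \<one> *\<^sub>v v = v"
  by (simp add: rho_one)

lemma w_carrier: "i < r \<Longrightarrow> w i \<in> carrier W"
  using w_closed by auto

lemma rho_inverse_vec:
  assumes "g \<in> carrier W" "v \<in> carrier_vec r"
  shows "\<rho> g *\<^sub>v (\<rho> (inv g) *\<^sub>v v) = v" "\<rho> (inv g) *\<^sub>v (\<rho> g *\<^sub>v v) = v"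
  using assms rho_mult_vec[of g "inv g" v] rho_mult_vec[of "inv g" g v] rho_one_vec by simp_all

text \<open>Since reflections are involutions, letters of both signs act as the same matrix, and the
  image of \<open>\<rho>\<close> is built by left multiplication with reflections.\<close>

lemma rho_induct [consumes 1, case_names one reflection]:
  assumes "g \<in> carrier W"
    and one: "P (1\<^sub>m r)"
    and step: "\<And>i h. i < r \<Longrightarrow> h \<in> carrier W \<Longrightarrow> P (\<rho> h) \<Longrightarrow> P (reflection i * \<rho> h)"
  shows "P (\<rho> g)"
proof -
  have "P (\<rho> (word_eval W w u))" if "u \<in> gwords {..<r}" for u
    using that
  proof (induction u)
    case Nil
    then show ?case using one by (simp add: rho_one)
  next
    case (Cons l u)
    obtain i b where l: "l = (i, b)" by (cases l)
    have i: "i < r" and u: "u \<in> gwords {..<r}" using Cons.prems l by auto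
    have c: "word_eval W w u \<in> carrier W" using word_eval_closed[OF w_closed u] .
    have "\<rho> (if b then w i else inv (w i)) = reflection i"
      using i w_carrier[OF i] by (simp add: rho_w rho.hom_inv reflection_inverse)
    then have "\<rho> (word_eval W w (l # u)) = reflection i * \<rho> (word_eval W w u)"
      using c w_carrier[OF i] rho_mult[of "if b then w i else inv (w i)" "word_eval W w u"] l by simp
    then show ?case using step[OF i c Cons.IH[OF u]] by simp
  qed
  then show ?thesis using assms(1) w_generates by auto
qed

lemma rho_preserves_form:
  assumes "g \<in> carrier W" "u \<in> carrier_vec r" "v \<in> carrier_vec r"
  shows "form (\<rho> g *\<^sub>v u) (\<rho> g *\<^sub>v v) = form u v"
  using assms(1)
proof (induction rule: rho_induct)
  case one
  then show ?case using assms by simp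
next
  case (reflection i h)
  have "(reflection i * \<rho> h) *\<^sub>v z = reflection i *\<^sub>v (\<rho> h *\<^sub>v z)" if "z \<in> carrier_vec r" for z
    using that reflection rho_carrier[of h] by (intro assoc_mult_mat_vec[of _ r r _ r]) auto
  then show ?case using reflection assms rho_vec by (simp add: reflection_preserves_form)
qed

lemma form_move:
  assumes "g \<in> carrier W" "u \<in> carrier_vec r" "v \<in> carrier_vec r"
  shows "form (\<rho> g *\<^sub>v u) v = form u (\<rho> (inv g) *\<^sub>v v)"
  using rho_preserves_form[OF assms(1,2) rho_vec[of "inv g" v]] assms by (simp add: rho_inverse_vec)

lemma rho_conjugate_reflection:
  assumes g: "g \<in> carrier W" and i: "i < r" and v: "v \<in> carrier_vec r"
  defines "\<alpha> \<equiv> \<rho> g *\<^sub>v unit_vec r i"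
  shows "\<rho> (g \<otimes> w i \<otimes> inv g) *\<^sub>v v = v - form \<alpha> v \<cdot>\<^sub>v \<alpha>"
proof -
  define z where "z = \<rho> (inv g) *\<^sub>v v"
  have z: "z \<in> carrier_vec r" unfolding z_def using g v by (intro rho_vec) auto
  have "\<rho> (g \<otimes> w i \<otimes> inv g) *\<^sub>v v = \<rho> g *\<^sub>v (reflection i *\<^sub>v z)"
    using g v w_carrier[OF i] z by (simp add: rho_mult_vec z_def[symmetric] rho_w i)
  also have "reflection i *\<^sub>v z = z - form \<alpha> v \<cdot>\<^sub>v unit_vec r i"
    using form_move[OF g _ v, of "unit_vec r i"] i z by (simp add: reflection_apply \<alpha>_def z_def)
  also have "\<rho> g *\<^sub>v \<dots> = \<rho> g *\<^sub>v z - form \<alpha> v \<cdot>\<^sub>v \<alpha>"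
    unfolding \<alpha>_def using rho_carrier[OF g] z
    by (simp add: mult_minus_distrib_mat_vec[of _ r r] mult_mat_vec_smult[OF rho_carrier[OF g]])
  also have "\<rho> g *\<^sub>v z = v" unfolding z_def by (rule rho_inverse_vec[OF g v])
  finally show ?thesis .
qed

text \<open>The order of the matrix modulo every \<open>k\<close> divides \<open>k\<close>. Elements of the kernel of \<open>\<rho>\<close>
  have this property trivially.\<close>

definition congruence_torsion :: "'a \<Rightarrow> bool" where
  "congruence_torsion x \<longleftrightarrow> (\<forall>k::nat. mat_cong r k (\<rho> (x [^] k)) (1\<^sub>m r))"

lemma mat_cong_rho_pow:
  assumes "g \<in> carrier W" "mat_cong r k (\<rho> g) (1\<^sub>m r)"
  shows "mat_cong r k (\<rho> (g [^] (n::nat))) (1\<^sub>m r)"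
proof (induction n)
  case 0
  then show ?case by (simp add: rho_one)
next
  case (Suc n)
  have "mat_cong r k (\<rho> (g [^] n) * \<rho> g) (1\<^sub>m r * 1\<^sub>m r)"
    using Suc assms rho_carrier by (intro mat_cong_mult) auto
  then show ?case using assms by (simp add: rho_mult)
qed

lemma mat_cong_rho_conj:
  assumes "g \<in> carrier W" "h \<in> carrier W" "mat_cong r k (\<rho> g) (1\<^sub>m r)"
  shows "mat_cong r k (\<rho> (h \<otimes> g \<otimes> inv h)) (1\<^sub>m r)"
proof -
  have "mat_cong r k (\<rho> h * \<rho> g * \<rho> (inv h)) (\<rho> h * 1\<^sub>m r * \<rho> (inv h))"
    using assms rho_carrier by (intro mat_cong_mult mat_cong_refl mult_carrier_mat[of _ r r]) auto
  moreover have "\<rho> h * 1\<^sub>m r = \<rho> h" using assms rho_carrier[of h] by simp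
  moreover have "\<rho> h * \<rho> (inv h) = 1\<^sub>m r"
    using assms rho_mult[of h "inv h"] by (simp add: rho_one)
  ultimately show ?thesis using assms by (simp add: rho_mult)
qed

lemma congruence_torsion_pow:
  assumes "x \<in> carrier W" "congruence_torsion x"
  shows "congruence_torsion (x [^] (n::nat))"
  unfolding congruence_torsion_def
proof
  fix k :: nat
  have "(x [^] n) [^] k = (x [^] k) [^] n" using assms by (simp add: nat_pow_pow mult.commute)
  then show "mat_cong r k (\<rho> ((x [^] n) [^] k)) (1\<^sub>m r)"
    using assms mat_cong_rho_pow[of "x [^] k" k n] by (simp add: congruence_torsion_def)
qed

lemma congruence_torsion_conj:
  assumes "x \<in> carrier W" "h \<in> carrier W" "congruence_torsion x"
  shows "congruence_torsion (h \<otimes> x \<otimes> inv h)"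
  using assms mat_cong_rho_conj by (simp add: congruence_torsion_def pow_conj)

text \<open>Modulo \<open>k\<close> the first matrix is trivial and modulo \<open>l\<close> the second one is, so they commute
  modulo both.\<close>

lemma mat_cong_commutator:
  assumes g: "g \<in> carrier W" and h: "h \<in> carrier W"
    and cong: "mat_cong r k (\<rho> g) (1\<^sub>m r)" "mat_cong r l (\<rho> h) (1\<^sub>m r)" and "coprime k l"
  shows "mat_cong r (k * l) (\<rho> (g \<otimes> h \<otimes> inv (h \<otimes> g))) (1\<^sub>m r)"
proof -
  have c: "\<rho> g \<in> carrier_mat r r" "\<rho> h \<in> carrier_mat r r" using g h rho_carrier by auto
  have 1: "mat_cong r k (\<rho> g * \<rho> h) (\<rho> h * \<rho> g)"
  proof (rule mat_cong_trans)
    show "mat_cong r k (\<rho> g * \<rho> h) (1\<^sub>m r * \<rho> h)" using c cong by (intro mat_cong_mult) auto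
    have "mat_cong r k (\<rho> h * \<rho> g) (\<rho> h * 1\<^sub>m r)" using c cong by (intro mat_cong_mult) auto
    then show "mat_cong r k (1\<^sub>m r * \<rho> h) (\<rho> h * \<rho> g)" using c by (simp add: mat_cong_sym)
  qed
  have 2: "mat_cong r l (\<rho> g * \<rho> h) (\<rho> h * \<rho> g)"
  proof (rule mat_cong_trans)
    show "mat_cong r l (\<rho> g * \<rho> h) (\<rho> g * 1\<^sub>m r)" using c cong by (intro mat_cong_mult) auto
    have "mat_cong r l (\<rho> h * \<rho> g) (1\<^sub>m r * \<rho> g)" using c cong by (intro mat_cong_mult) auto
    then show "mat_cong r l (\<rho> g * 1\<^sub>m r) (\<rho> h * \<rho> g)" using c by (simp add: mat_cong_sym)
  qed
  have "mat_cong r (k * l) (\<rho> (g \<otimes> h)) (\<rho> (h \<otimes> g))"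
    using mat_cong_coprime[OF 1 2] assms by (simp add: rho_mult)
  then have "mat_cong r (k * l) (\<rho> (g \<otimes> h) * \<rho> (inv (h \<otimes> g))) (\<rho> (h \<otimes> g) * \<rho> (inv (h \<otimes> g)))"
    using g h rho_carrier by (intro mat_cong_mult) auto
  moreover have "\<rho> (h \<otimes> g) * \<rho> (inv (h \<otimes> g)) = 1\<^sub>m r"
    using g h rho_mult[of "h \<otimes> g" "inv (h \<otimes> g)"] by (simp add: rho_one)
  ultimately show ?thesis using g h by (simp add: rho_mult)
qed

end

section \<open>Subgroups of finite index\<close>

lemma finite_image_factor:
  assumes "finite (\<Phi> ` A)" and "\<And>x y. x \<in> A \<Longrightarrow> y \<in> A \<Longrightarrow> \<Phi> x = \<Phi> y \<Longrightarrow> f x = f y"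
  shows "finite (f ` A)"
proof -
  have "f ` A \<subseteq> (\<lambda>p. f (SOME x. x \<in> A \<and> \<Phi> x = p)) ` (\<Phi> ` A)"
  proof
    fix z assume "z \<in> f ` A"
    then obtain x where x: "x \<in> A" "z = f x" by auto
    define y where "y = (SOME y. y \<in> A \<and> \<Phi> y = \<Phi> x)"
    have "y \<in> A \<and> \<Phi> y = \<Phi> x" unfolding y_def by (rule someI[of _ x]) (use x in simp)
    then have "z = f y" using assms(2) x by metis
    then show "z \<in> (\<lambda>p. f (SOME x. x \<in> A \<and> \<Phi> x = p)) ` (\<Phi> ` A)"
      using x by (auto simp: y_def)
  qed
  then show ?thesis using assms(1) finite_surj finite_imageI finite_subset by blast
qed

lemma two_power_odd_decomposition:
  assumes "0 < (k::nat)"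
  obtains a l where "k = 2 ^ a * l" "odd l"
proof -
  have "\<exists>a l. k = 2 ^ a * l \<and> odd l"
    using assms
  proof (induction k rule: less_induct)
    case (less k)
    show ?case
    proof (cases "odd k")
      case True
      then show ?thesis by (intro exI[of _ 0] exI[of _ k]) simp
    next
      case False
      then obtain j where j: "k = 2 * j" by auto
      then obtain a l where "j = 2 ^ a * l" "odd l" using less by (metis nat_0_less_mult_iff less_add_same_cancel1 mult_2)
      then show ?thesis using j by (intro exI[of _ "Suc a"] exI[of _ l]) simp
    qed
  qed
  then show thesis using that by blast
qed

context group
begin

lemma rcosets_equal:
  assumes "subgroup H G" "a \<in> carrier G" "b \<in> carrier G" "a \<otimes> inv b \<in> H"
  shows "H #> a = H #> b"
  using assms subgroup.rcos_module[OF assms(1) is_group assms(3,2)] repr_independence[of a H b] by auto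

lemma rcosets_equalD:
  assumes "subgroup H G" "a \<in> carrier G" "b \<in> carrier G" "H #> a = H #> b"
  shows "a \<otimes> inv b \<in> H"
  using assms rcos_self[of a H] subgroup.rcos_module[OF assms(1) is_group assms(3,2)] by auto

lemma rcosets_image: "rcosets H = (\<lambda>g. H #> g) ` carrier G"
  by (auto simp: RCOSETS_def)

lemma finite_range_pow_repeats:
  assumes "finite (f ` carrier G)" "u \<in> carrier G"
  obtains i j :: nat where "i < j" "f (u [^] i) = f (u [^] j)"
proof -
  have "finite (range (\<lambda>n::nat. f (u [^] n)))"
    by (rule finite_subset[OF _ assms(1)]) (use assms(2) in auto)
  then have "\<not> inj (\<lambda>n::nat. f (u [^] n))" by (metis finite_imageD infinite_UNIV_nat)
  then obtain i j :: nat where "i \<noteq> j" "f (u [^] i) = f (u [^] j)" by (auto simp: inj_def)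
  then show thesis using that by (metis nat_neq_iff)
qed

lemma pow_diff:
  assumes "u \<in> carrier G" "i \<le> (j::nat)"
  shows "u [^] j \<otimes> inv (u [^] i) = u [^] (j - i)"
proof -
  have "u [^] j = u [^] (j - i) \<otimes> u [^] i" using assms by (simp add: nat_pow_mult)
  then show ?thesis using assms by (simp add: m_assoc)
qed

lemma finite_index_pow_mem:
  assumes F: "finite_index_subgroup F G" and u: "u \<in> carrier G"
  obtains n :: nat where "0 < n" "u [^] n \<in> F"
proof -
  have sub: "subgroup F G" and "finite ((\<lambda>g. F #> g) ` carrier G)"
    using F by (auto simp: finite_index_subgroup_def rcosets_image)
  then obtain i j :: nat where "i < j" "F #> u [^] i = F #> u [^] j"
    using finite_range_pow_repeats u by blast
  then have "u [^] (j - i) \<in> F"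
    using rcosets_equalD[OF sub, of "u [^] j" "u [^] i"] u pow_diff[OF u, of i j] by simp
  then show thesis using that[of "j - i"] \<open>i < j\<close> by simp
qed

text \<open>A coset of the kernel is determined by the coset of \<open>F\<close> it lies in and by the value of \<open>\<theta>\<close>
  after translation to \<open>F\<close> by a fixed representative.\<close>

lemma finite_index_kernel:
  assumes F: "finite_index_subgroup F G" and Q: "group Q" "finite (carrier Q)"
    and \<theta>: "\<theta> \<in> hom (G\<lparr>carrier := F\<rparr>) Q"
  shows "finite_index_subgroup {g \<in> F. \<theta> g = \<one>\<^bsub>Q\<^esub>} G"
proof -
  define H where "H = {g \<in> F. \<theta> g = \<one>\<^bsub>Q\<^esub>}"
  have F_sub: "subgroup F G" and fin: "finite ((\<lambda>g. F #> g) ` carrier G)"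
    using F by (auto simp: finite_index_subgroup_def rcosets_image)
  interpret F: group "G\<lparr>carrier := F\<rparr>" using subgroup_imp_group[OF F_sub] .
  interpret \<theta>: group_hom "G\<lparr>carrier := F\<rparr>" Q \<theta>
    using \<theta> Q F.is_group by (simp add: group_hom_def group_hom_axioms_def)
  note F_simps = subgroup.m_closed[OF F_sub] subgroup.m_inv_closed[OF F_sub] subgroup.one_closed[OF F_sub]
    subgroup.mem_carrier[OF F_sub]
  have mult: "\<theta> (a \<otimes> b) = \<theta> a \<otimes>\<^bsub>Q\<^esub> \<theta> b" if "a \<in> F" "b \<in> F" for a b
    using \<theta>.hom_mult[of a b] that by simp
  have inv: "\<theta> (inv a) = inv\<^bsub>Q\<^esub> \<theta> a" if "a \<in> F" for a
    using \<theta>.hom_inv[of a] that m_inv_consistent[OF F_sub that] by simp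
  have clos: "\<theta> a \<in> carrier Q" if "a \<in> F" for a using \<theta>.hom_closed[of a] that by simp
  have one: "\<theta> \<one> = \<one>\<^bsub>Q\<^esub>" using \<theta>.hom_one by simp
  have H: "subgroup H G"
    by (rule subgroupI) (use F_simps one in \<open>auto simp: H_def mult inv\<close>)
  define t where "t C = (SOME g. g \<in> carrier G \<and> F #> g = C)" for C
  have t: "t (F #> g) \<in> carrier G \<and> F #> t (F #> g) = F #> g" if "g \<in> carrier G" for g
    unfolding t_def by (rule someI[of _ g]) (use that in simp)
  have mem: "g \<otimes> inv (t (F #> g)) \<in> F" if "g \<in> carrier G" for g
    using rcosets_equalD[OF F_sub that, of "t (F #> g)"] t[OF that] by simp
  define \<Phi> where "\<Phi> g = (F #> g, \<theta> (g \<otimes> inv (t (F #> g))))" for g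
  have "finite (\<Phi> ` carrier G)"
    by (rule finite_subset[of _ "((\<lambda>g. F #> g) ` carrier G) \<times> carrier Q"])
      (use fin Q mem clos in \<open>auto simp: \<Phi>_def\<close>)
  moreover have "H #> g = H #> h" if g: "g \<in> carrier G" and h: "h \<in> carrier G" and eq: "\<Phi> g = \<Phi> h" for g h
  proof -
    define s where "s = t (F #> h)"
    have s: "s \<in> carrier G" using t[OF h] by (simp add: s_def)
    have c: "F #> g = F #> h" using eq by (simp add: \<Phi>_def)
    have a: "g \<otimes> inv s \<in> F" "h \<otimes> inv s \<in> F" "\<theta> (g \<otimes> inv s) = \<theta> (h \<otimes> inv s)"
      using mem[OF g] mem[OF h] eq unfolding \<Phi>_def s_def c by simp_all
    have "inv s \<otimes> (s \<otimes> inv h) = inv h" using h s by (simp add: m_assoc[symmetric])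
    then have gh: "(g \<otimes> inv s) \<otimes> inv (h \<otimes> inv s) = g \<otimes> inv h"
      using g h s by (simp add: inv_mult_group m_assoc)
    have "\<theta> ((g \<otimes> inv s) \<otimes> inv (h \<otimes> inv s)) = \<one>\<^bsub>Q\<^esub>"
      using a clos[OF a(2)] F_simps(2)[OF a(2)] by (simp only: mult inv) simp
    moreover have "(g \<otimes> inv s) \<otimes> inv (h \<otimes> inv s) \<in> F"
      using a F_simps by blast
    ultimately have "g \<otimes> inv h \<in> H" by (simp add: H_def gh)
    then show ?thesis using rcosets_equal[OF H g h] by simp
  qed
  ultimately have "finite ((\<lambda>g. H #> g) ` carrier G)" by (rule finite_image_factor)
  then show ?thesis using H by (simp add: finite_index_subgroup_def rcosets_image H_def)
qed

end

section \<open>The Tits representation and the obstruction\<close>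

context reflection_representation
begin

lemma reflection_tits:
  fixes v :: "real vec"
  assumes basis: "\<And>i j. i < r \<Longrightarrow> j < r \<Longrightarrow> 2 * tits_form_basis m i j = real_of_int (c i j)"
    and v: "v \<in> carrier_vec r" and i: "i < r"
  shows "map_mat real_of_int (reflection i) *\<^sub>v v = tits_reflection r m i v"
proof (rule eq_vecI)
  have "tits_form r m (unit_vec r i) v = (\<Sum>a<r. if a = i then \<Sum>b<r. tits_form_basis m a b * v $ b else 0)"
    unfolding tits_form_def by (intro sum.cong HOL.refl) (use i in auto)
  then have "2 * tits_form r m (unit_vec r i) v = (\<Sum>b<r. real_of_int (c i b) * v $ b)"
    using i by (simp add: sum_distrib_left basis[symmetric] mult.assoc)
  note form = this
  fix a assume "a < dim_vec (tits_reflection r m i v)"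
  then have a: "a < r" by (simp add: tits_reflection_def)
  have "(map_mat real_of_int (reflection i) *\<^sub>v v) $ a
      = (\<Sum>b<r. ((if a = b then 1 else 0) - (if a = i then real_of_int (c i b) else 0)) * v $ b)"
    using a v by (auto simp: reflection_def scalar_prod_def atLeast0LessThan intro!: sum.cong)
  also have "\<dots> = (\<Sum>b<r. if a = b then v $ b else 0)
      - (if a = i then \<Sum>b<r. real_of_int (c i b) * v $ b else 0)"
    by (simp add: left_diff_distrib sum_subtractf if_distrib[of "\<lambda>x. x * _"] cong: if_cong)
  finally show "(map_mat real_of_int (reflection i) *\<^sub>v v) $ a = tits_reflection r m i v $ a"
    using a i v by (simp add: tits_reflection_def form)
qed (use v in \<open>simp add: reflection_def tits_reflection_def\<close>)

text \<open>The defining description of the Tits representation has a unique solution: \<open>\<rho>\<close> over the reals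
  satisfies it, and a homomorphism is determined by the generators, whose matrices are
  determined by their action on vectors.\<close>

lemma tits_rep_eq:
  assumes basis: "\<And>i j. i < r \<Longrightarrow> j < r \<Longrightarrow> 2 * tits_form_basis m i j = real_of_int (c i j)"
    and g: "g \<in> carrier W"
  shows "tits_rep W r w m g = map_mat real_of_int (\<rho> g)"
proof -
  let ?real = "map_mat real_of_int :: int mat \<Rightarrow> real mat"
  have GL: "group (GL_real r)" unfolding GL_real_def by (rule group_units_ring_mat)
  have GL_carrier: "A \<in> carrier_mat r r" if "A \<in> carrier (GL_real r)" for A
    using that by (simp add: GL_real_def units_ring_mat_simps)
  have real_mult: "?real (A * B) = ?real A * ?real B"
    if "A \<in> carrier_mat r r" "B \<in> carrier_mat r r" for A B
    using of_int_hom.mat_hom_mult[OF that] .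
  have real_one: "?real (1\<^sub>m r) = 1\<^sub>m r" by (rule of_int_hom.mat_hom_one)
  define R where "R = restrict (\<lambda>g. ?real (\<rho> g)) (carrier W)"
  have R_hom: "R \<in> hom W (GL_real r)"
  proof (rule homI)
    fix x assume x: "x \<in> carrier W"
    have "?real (\<rho> (inv x)) * ?real (\<rho> x) = 1\<^sub>m r" "?real (\<rho> x) * ?real (\<rho> (inv x)) = 1\<^sub>m r"
      using x rho_carrier by (simp_all add: real_mult[symmetric] rho_mult[symmetric] rho_one real_one)
    then show "R x \<in> carrier (GL_real r)"
      unfolding GL_real_def units_ring_mat_simps using x rho_carrier
      by (auto simp: R_def intro!: bexI[of _ "?real (\<rho> (inv x))"])
  next
    fix x y assume "x \<in> carrier W" "y \<in> carrier W"
    then show "R (x \<otimes> y) = R x \<otimes>\<^bsub>GL_real r\<^esub> R y"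
      unfolding GL_real_def units_ring_mat_simps using rho_carrier
      by (simp add: R_def rho_mult real_mult)
  qed
  have R_w: "R (w i) = ?real (reflection i)" if "i < r" for i
    using that w_carrier by (simp add: R_def rho_w)
  have "tits_rep W r w m = R"
    unfolding tits_rep_def
  proof (rule the_equality)
    show "R \<in> hom W (GL_real r) \<and> R \<in> extensional (carrier W) \<and>
      (\<forall>i<r. \<forall>v\<in>carrier_vec r. R (w i) *\<^sub>v v = tits_reflection r m i v)"
      using R_hom R_w reflection_tits[OF basis] by (auto simp: R_def)
  next
    fix S assume S: "S \<in> hom W (GL_real r) \<and> S \<in> extensional (carrier W) \<and>
      (\<forall>i<r. \<forall>v\<in>carrier_vec r. S (w i) *\<^sub>v v = tits_reflection r m i v)"
    have Sw: "S (w i) = R (w i)" if i: "i < r" for i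
    proof (rule mat_eq_by_action)
      show "S (w i) \<in> carrier_mat r r" "R (w i) \<in> carrier_mat r r"
        using S GL_carrier[OF hom_in_carrier[OF _ w_carrier[OF i]]] R_hom by blast+
      show "S (w i) *\<^sub>v v = R (w i) *\<^sub>v v" if "v \<in> carrier_vec r" for v
        using S that i by (simp add: R_w reflection_tits[OF basis])
    qed
    have eq: "word_eval (GL_real r) (\<lambda>i. S (w i)) u = word_eval (GL_real r) (\<lambda>i. R (w i)) u"
      if "u \<in> gwords {..<r}" for u
      by (rule group.word_eval_cong[OF GL _ that]) (simp only: lessThan_iff Sw)
    show "S = R"
    proof (rule extensionalityI[of _ "carrier W"])
      fix x assume "x \<in> carrier W"
      then obtain u where u: "u \<in> gwords {..<r}" "x = word_eval W w u" using w_generates by auto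
      have "S x = word_eval (GL_real r) (\<lambda>i. S (w i)) u"
        unfolding u(2) by (rule word_eval_hom[OF _ GL w_closed u(1)]) (use S in blast)
      also have "\<dots> = word_eval (GL_real r) (\<lambda>i. R (w i)) u" by (rule eq[OF u(1)])
      also have "\<dots> = R x"
        unfolding u(2) by (rule word_eval_hom[OF R_hom GL w_closed u(1), symmetric])
      finally show "S x = R x" .
    qed (use S in \<open>auto simp: R_def\<close>)
  qed
  then show ?thesis using g by (simp add: R_def)
qed

lemma mem_principal_congruence_subgroup:
  assumes basis: "\<And>i j. i < r \<Longrightarrow> j < r \<Longrightarrow> 2 * tits_form_basis m i j = real_of_int (c i j)"
    and g: "g \<in> carrier W" and cong: "mat_cong r k (\<rho> g) (1\<^sub>m r)"
  shows "g \<in> principal_congruence_subgroup W r w m k"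
  unfolding principal_congruence_subgroup_def
  using g cong tits_rep_eq[OF basis g] rho_carrier[OF g]
  unfolding mat_cong_def by (intro CollectI conjI bexI[of _ "\<rho> g"]) auto

text \<open>The kernel \<open>H\<close> of \<open>\<theta>\<close> contains no principal congruence subgroup: for level \<open>k = 2\<^sup>a l\<close>
  the commutator of \<open>x\<^sup>l\<close> and \<open>y\<close> raised to \<open>2\<^sup>a\<^sup>+\<^sup>1\<close> is congruent to the identity, but
  \<open>\<theta>\<close> does not kill it.\<close>

lemma no_congruence_subgroup_property:
  assumes basis: "\<And>i j. i < r \<Longrightarrow> j < r \<Longrightarrow> 2 * tits_form_basis m i j = real_of_int (c i j)"
    and F: "finite_index_subgroup F W" and Q: "group Q" "finite (carrier Q)"
    and \<theta>: "\<theta> \<in> hom (W\<lparr>carrier := F\<rparr>) Q"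
    and x: "x \<in> F" "congruence_torsion x" and y: "y \<in> F" "congruence_torsion y"
    and sep: "separated_pair Q (\<theta> x) (\<theta> y)"
  shows "\<not> congruence_subgroup_property W r w m"
proof
  assume csp: "congruence_subgroup_property W r w m"
  define H where "H = {g \<in> F. \<theta> g = \<one>\<^bsub>Q\<^esub>}"
  have "finite_index_subgroup H W"
    unfolding H_def by (rule finite_index_kernel[OF F Q \<theta>])
  then obtain k where k: "2 \<le> k" "principal_congruence_subgroup W r w m k \<subseteq> H"
    using csp by (auto simp: congruence_subgroup_property_def)
  then obtain a l where kal: "k = 2 ^ a * l" and l: "odd l"
    using two_power_odd_decomposition[of k] by auto
  have F_sub: "subgroup F W" using F by (simp add: finite_index_subgroup_def)
  interpret F: group "W\<lparr>carrier := F\<rparr>" using subgroup_imp_group[OF F_sub] .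
  interpret \<theta>: group_hom "W\<lparr>carrier := F\<rparr>" Q \<theta>
    using \<theta> Q F.is_group by (simp add: group_hom_def group_hom_axioms_def)
  have \<theta>_mult: "\<theta> (a \<otimes> b) = \<theta> a \<otimes>\<^bsub>Q\<^esub> \<theta> b" if "a \<in> F" "b \<in> F" for a b
    using \<theta>.hom_mult[of a b] that by simp
  have \<theta>_pow: "\<theta> (z [^] (n::nat)) = \<theta> z [^]\<^bsub>Q\<^esub> n" if "z \<in> F" for z n
    using \<theta>.hom_nat_pow[of z n] that by (simp add: nat_pow_consistent[symmetric])
  have xy: "x \<in> carrier W" "y \<in> carrier W" using x y subgroup.mem_carrier[OF F_sub] by auto
  have pow_F: "z [^] (n::nat) \<in> F" if "z \<in> F" for z n
    using F.nat_pow_closed[of z n] that by (simp add: nat_pow_consistent[symmetric])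
  define g where "g = x [^] l"
  \<comment> \<open>The exponent \<open>2\<^sup>a\<close> would be \<open>1\<close> for odd \<open>k\<close>, which \<open>separated_pair\<close> does not cover.\<close>
  define h where "h = y [^] (2 ^ Suc a :: nat)"
  have gh: "g \<in> carrier W" "h \<in> carrier W" using xy by (auto simp: g_def h_def)
  have ghF: "g \<in> F" "h \<in> F" using x y pow_F by (auto simp: g_def h_def)
  have "mat_cong r l (\<rho> g) (1\<^sub>m r)"
    using x by (simp add: g_def congruence_torsion_def)
  moreover have "mat_cong r (2 ^ a) (\<rho> h) (1\<^sub>m r)"
  proof -
    have "h = (y [^] (2 ^ a :: nat)) [^] (2 :: nat)"
      using xy by (simp add: h_def nat_pow_pow mult.commute)
    then show ?thesis
      using mat_cong_rho_pow[of "y [^] (2 ^ a :: nat)" "2 ^ a" 2] xy y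
      by (simp add: congruence_torsion_def)
  qed
  ultimately have "mat_cong r (l * 2 ^ a) (\<rho> (g \<otimes> h \<otimes> inv (h \<otimes> g))) (1\<^sub>m r)"
    using l by (intro mat_cong_commutator gh) auto
  define z where "z = g \<otimes> h \<otimes> inv (h \<otimes> g)"
  have z: "z \<in> carrier W" using gh by (simp add: z_def)
  have "z \<in> principal_congruence_subgroup W r w m k"
    using mem_principal_congruence_subgroup[OF basis z, of "l * 2 ^ a"]
      \<open>mat_cong r (l * 2 ^ a) (\<rho> (g \<otimes> h \<otimes> inv (h \<otimes> g))) (1\<^sub>m r)\<close>
    by (simp add: z_def kal mult.commute)
  then have zF: "z \<in> F" "\<theta> z = \<one>\<^bsub>Q\<^esub>" using k by (auto simp: H_def)
  have "g \<otimes> h = z \<otimes> (h \<otimes> g)" using gh by (simp add: z_def m_assoc)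
  then have "\<theta> (g \<otimes> h) = \<theta> z \<otimes>\<^bsub>Q\<^esub> \<theta> (h \<otimes> g)"
    using zF ghF subgroup.m_closed[OF F_sub] by (simp only: \<theta>_mult)
  then have "\<theta> g \<otimes>\<^bsub>Q\<^esub> \<theta> h = \<theta> h \<otimes>\<^bsub>Q\<^esub> \<theta> g"
    using zF ghF \<theta>.hom_closed[of g] \<theta>.hom_closed[of h] by (simp add: \<theta>_mult group.is_monoid[OF Q(1)] monoid.l_one monoid.m_closed)
  then show False
    using sep l x y by (auto simp: separated_pair_def g_def h_def \<theta>_pow)
qed

end

section \<open>Elements whose order modulo k divides k\<close>

text \<open>Detected by the exponent sum of a word, a homomorphism to the integers.\<close>

lemma free_generator_pow_neq_one:
  assumes G: "group G" and pres: "has_presentation G X (\<lambda>x. x) {}" and a: "a \<in> X" and n: "0 < (n::nat)"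
  shows "a [^]\<^bsub>G\<^esub> n \<noteq> \<one>\<^bsub>G\<^esub>"
proof -
  interpret G: group G by fact
  have ac: "a \<in> carrier G" using has_presentation_generates(1)[OF G pres] a by auto
  obtain h where h: "h \<in> hom G integer_group" "\<And>x. x \<in> X \<Longrightarrow> h x = 1"
    by (rule has_presentation_lift[OF G pres group_integer_group, of "\<lambda>_. 1"]) (simp, simp, blast)
  interpret h: group_hom G integer_group h
    using h(1) by (simp add: group_hom_def group_hom_axioms_def G.is_group)
  have "h (a [^]\<^bsub>G\<^esub> k) = int k" for k :: nat
    by (induction k) (use h.hom_mult ac h.hom_one h(2)[OF a] in auto)
  then show ?thesis using n h.hom_one by (metis of_nat_0_eq_iff one_integer_group less_irrefl)
qed

context reflection_representation
begin

text \<open>With \<open>\<gamma> = \<beta> - \<epsilon>\<alpha>\<close>, which is isotropic and orthogonal to \<open>\<alpha>\<close> and \<open>\<beta>\<close>, the operator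
  \<open>N = \<rho>(u) - 1\<close> is \<open>N v = \<epsilon>(\<gamma>,v)\<alpha> - (\<beta>,v)\<gamma>\<close>. Hence \<open>N\<^sup>2 v = -2(\<gamma>,v)\<gamma>\<close> and \<open>N\<^sup>3 = 0\<close>,
  and the formula is the binomial expansion of \<open>(1 + N)\<^sup>n\<close>. The factor \<open>2\<close> in \<open>N\<^sup>2\<close> cancels the
  denominator of the binomial coefficient, so that \<open>n\<close> divides everything but \<open>v\<close>.\<close>

lemma rho_reflection_product:
  assumes g: "g \<in> carrier W" and i: "i < r" and j: "j < r" and v: "v \<in> carrier_vec r"
    and \<epsilon>: "\<epsilon> = 1 \<or> \<epsilon> = -1"
  defines "\<alpha> \<equiv> \<rho> g *\<^sub>v unit_vec r i" and "\<beta> \<equiv> unit_vec r j"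
  defines "\<gamma> \<equiv> \<beta> - \<epsilon> \<cdot>\<^sub>v \<alpha>"
  assumes \<alpha>\<beta>: "form \<alpha> \<beta> = 2 * \<epsilon>" and a: "a < r"
  defines "u \<equiv> (g \<otimes> w i \<otimes> inv g) \<otimes> w j"
  shows "(\<rho> (u [^] (n::nat)) *\<^sub>v v) $ a =
    v $ a + int n * (\<epsilon> * form \<gamma> v * \<alpha> $ a - form \<beta> v * \<gamma> $ a) - int n * (int n - 1) * form \<gamma> v * \<gamma> $ a"
  using v
proof (induction n arbitrary: v)
  case 0
  then show ?case by (simp add: rho_one)
next
  case (Suc n)
  have \<alpha>: "\<alpha> \<in> carrier_vec r" unfolding \<alpha>_def using g by (intro rho_vec) auto
  have \<beta>: "\<beta> \<in> carrier_vec r" by (simp add: \<beta>_def)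
  have wc: "g \<otimes> w i \<otimes> inv g \<in> carrier W" "w j \<in> carrier W" "u \<in> carrier W"
    using g w_carrier i j by (auto simp: u_def)
  have norms: "form \<alpha> \<alpha> = 2" "form \<beta> \<beta> = 2" "form \<beta> \<alpha> = 2 * \<epsilon>"
    using rho_preserves_form[OF g, of "unit_vec r i" "unit_vec r i"] i j c_diag \<alpha>\<beta> form_sym[of \<beta> \<alpha>]
    by (simp_all add: \<alpha>_def \<beta>_def)
  have \<gamma>: "form \<gamma> z = form \<beta> z - \<epsilon> * form \<alpha> z" for z
    unfolding \<gamma>_def by (rule form_diff(2)[OF \<beta> \<alpha>])
  define y where "y = v - form \<beta> v \<cdot>\<^sub>v \<beta>"
  have y: "y \<in> carrier_vec r" using \<beta> Suc.prems by (simp add: y_def)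
  define v' where "v' = y - form \<alpha> y \<cdot>\<^sub>v \<alpha>"
  have v': "v' \<in> carrier_vec r" using \<alpha> y by (simp add: v'_def)
  have "\<rho> u *\<^sub>v v = \<rho> (g \<otimes> w i \<otimes> inv g) *\<^sub>v (\<rho> (w j) *\<^sub>v v)"
    unfolding u_def by (rule rho_mult_vec[OF wc(1,2) Suc.prems])
  also have "\<rho> (w j) *\<^sub>v v = y"
    using j Suc.prems by (simp add: rho_w reflection_apply y_def \<beta>_def)
  also have "\<rho> (g \<otimes> w i \<otimes> inv g) *\<^sub>v y = v'"
    unfolding v'_def \<alpha>_def by (rule rho_conjugate_reflection[OF g i y])
  finally have uv: "\<rho> u *\<^sub>v v = v'" .
  have uSuc: "\<rho> (u [^] Suc n) *\<^sub>v v = \<rho> (u [^] n) *\<^sub>v v'"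
    using wc rho_mult_vec[of "u [^] n" u v] Suc.prems uv by simp
  have "form \<alpha> y = form \<alpha> v - 2 * \<epsilon> * form \<beta> v"
    unfolding y_def form_diff(1)[OF Suc.prems \<beta>] \<alpha>\<beta> by simp
  note \<alpha>y = this
  have form_v': "form z v' = form z v - form \<beta> v * form z \<beta> - form \<alpha> y * form z \<alpha>" for z
    unfolding v'_def form_diff(1)[OF y \<alpha>] unfolding y_def form_diff(1)[OF Suc.prems \<beta>] ..
  have \<gamma>v': "form \<gamma> v' = form \<gamma> v"
    using \<epsilon> unfolding \<gamma> form_v' \<alpha>y norms \<alpha>\<beta> by (elim disjE) simp_all
  have \<beta>v': "form \<beta> v' = form \<beta> v + 2 * form \<gamma> v"
    using \<epsilon> unfolding \<gamma> form_v' \<alpha>y norms \<alpha>\<beta> by (elim disjE) simp_all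
  have va: "v' $ a = v $ a - form \<beta> v * \<beta> $ a - form \<alpha> y * \<alpha> $ a"
    using a \<alpha> \<beta> Suc.prems by (simp add: v'_def y_def)
  have \<gamma>a: "\<gamma> $ a = \<beta> $ a - \<epsilon> * \<alpha> $ a"
    using a \<alpha> \<beta> by (simp add: \<gamma>_def)
  have v'a: "v' $ a = v $ a - form \<beta> v * \<gamma> $ a + \<epsilon> * form \<gamma> v * \<alpha> $ a"
    using \<epsilon> unfolding va \<gamma>a \<gamma> \<alpha>y by (elim disjE) (simp_all add: algebra_simps)
  show ?case
    unfolding uSuc Suc.IH[OF v'] \<gamma>v' \<beta>v' v'a by (simp add: algebra_simps)
qed

text \<open>The element has infinite order because \<open>u\<^sup>n \<alpha> = \<alpha> - 2\<epsilon>n\<gamma>\<close>, where \<open>\<gamma> \<noteq> 0\<close>.\<close>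

lemma parabolic_product:
  assumes g: "g \<in> carrier W" and i: "i < r" and j: "j < r"
    and two: "\<bar>form (\<rho> g *\<^sub>v unit_vec r i) (unit_vec r j)\<bar> = 2"
    and ne: "\<rho> g *\<^sub>v unit_vec r i \<noteq> unit_vec r j" "\<rho> g *\<^sub>v unit_vec r i \<noteq> - unit_vec r j"
  defines "u \<equiv> (g \<otimes> w i \<otimes> inv g) \<otimes> w j"
  shows "congruence_torsion u" and "0 < n \<Longrightarrow> u [^] (n::nat) \<noteq> \<one>"
proof -
  define \<alpha> where "\<alpha> = \<rho> g *\<^sub>v unit_vec r i"
  define \<beta> :: "int vec" where "\<beta> = unit_vec r j"
  define \<epsilon> :: int where "\<epsilon> = form \<alpha> \<beta> div 2"
  define \<gamma> where "\<gamma> = \<beta> - \<epsilon> \<cdot>\<^sub>v \<alpha>"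
  have pm: "form \<alpha> \<beta> = 2 \<or> form \<alpha> \<beta> = - 2"
    using two unfolding \<alpha>_def \<beta>_def by linarith
  have \<epsilon>: "\<epsilon> = 1 \<or> \<epsilon> = -1" "form \<alpha> \<beta> = 2 * \<epsilon>"
    using pm by (auto simp: \<epsilon>_def)
  have \<alpha>: "\<alpha> \<in> carrier_vec r" unfolding \<alpha>_def using g by (intro rho_vec) auto
  have \<beta>: "\<beta> \<in> carrier_vec r" by (simp add: \<beta>_def)
  have u: "u \<in> carrier W" using g w_carrier i j by (auto simp: u_def)
  have power: "(\<rho> (u [^] (n::nat)) *\<^sub>v v) $ a =
    v $ a + int n * (\<epsilon> * form \<gamma> v * \<alpha> $ a - form \<beta> v * \<gamma> $ a) - int n * (int n - 1) * form \<gamma> v * \<gamma> $ a"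
    if "v \<in> carrier_vec r" "a < r" for n v a
    using rho_reflection_product[OF g i j that(1) \<epsilon>(1) _ that(2), of n] \<epsilon>(2)
    by (simp add: \<alpha>_def \<beta>_def \<gamma>_def u_def)
  show "congruence_torsion u"
    unfolding congruence_torsion_def mat_cong_def
  proof (intro allI impI)
    fix k a b :: nat assume ab: "a < r" "b < r"
    define e :: "int vec" where "e = unit_vec r b"
    have "\<rho> (u [^] k) $$ (a, b) = (\<rho> (u [^] k) *\<^sub>v e) $ a"
      unfolding e_def using ab rho_carrier[OF nat_pow_closed[OF u], of k] by (intro mult_mat_unit_vec[symmetric]) auto
    also have "\<dots> = e $ a + int k * (\<epsilon> * form \<gamma> e * \<alpha> $ a - form \<beta> e * \<gamma> $ a)
        - int k * (int k - 1) * form \<gamma> e * \<gamma> $ a"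
      using ab by (intro power) (auto simp: e_def)
    also have "\<dots> = (1\<^sub>m r) $$ (a, b) + int k * ((\<epsilon> * form \<gamma> e * \<alpha> $ a - form \<beta> e * \<gamma> $ a)
        - (int k - 1) * form \<gamma> e * \<gamma> $ a)"
      using ab by (simp add: e_def right_diff_distrib mult.assoc)
    finally show "[\<rho> (u [^] k) $$ (a, b) = (1\<^sub>m r) $$ (a, b)] (mod int k)"
      by (simp add: cong_iff_dvd_diff)
  qed
  assume n: "0 < n"
  show "u [^] n \<noteq> \<one>"
  proof
    assume one: "u [^] n = \<one>"
    have norms: "form \<alpha> \<alpha> = 2" "form \<beta> \<alpha> = 2 * \<epsilon>"
      using rho_preserves_form[OF g, of "unit_vec r i" "unit_vec r i"] i c_diag \<epsilon>(2) form_sym[of \<beta> \<alpha>]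
      by (simp_all add: \<alpha>_def)
    have \<gamma>\<alpha>: "form \<gamma> \<alpha> = 0"
      unfolding \<gamma>_def form_diff(2)[OF \<beta> \<alpha>] norms by simp
    have "\<gamma> $ a = 0" if a: "a < r" for a
      using power[OF \<alpha> a, of n] one \<alpha> a n \<epsilon> by (auto simp: \<gamma>\<alpha> norms rho_one)
    then have "\<beta> $ a = \<epsilon> * \<alpha> $ a" if "a < r" for a
      using that \<alpha> \<beta> by (simp add: \<gamma>_def)
    then have "\<alpha> $ a = \<epsilon> * \<beta> $ a" if "a < r" for a
      using that \<epsilon>(1) by auto
    then have "\<alpha> = \<epsilon> \<cdot>\<^sub>v \<beta>" using \<alpha> \<beta> by (intro eq_vecI) auto
    moreover have "(-1) \<cdot>\<^sub>v \<beta> = - \<beta>" "1 \<cdot>\<^sub>v \<beta> = \<beta>" by (auto intro!: eq_vecI)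
    ultimately show False
      using \<epsilon>(1) ne by (auto simp: \<alpha>_def \<beta>_def)
  qed
qed

text \<open>The inner product \<open>(\<alpha>, e\<^sub>j)\<close> of a root with a simple root never jumps over \<open>\<plusminus>2\<close> when a
  simple reflection is applied to \<open>\<alpha>\<close>, and by hypothesis the value \<open>\<plusminus>2\<close> occurs only for
  \<open>\<alpha> = \<plusminus>e\<^sub>j\<close>. So these inner products are bounded by \<open>2\<close> along all words. They also determine
  the root: if \<open>\<alpha>\<close> and \<open>\<beta>\<close> have the same ones then \<open>(\<alpha>,\<beta>) = (\<beta>,\<beta>) = 2\<close>, and moving \<open>\<beta>\<close> to
  a simple root shows \<open>\<alpha> = \<beta>\<close>. Therefore finitely many numbers determine \<open>\<rho> g\<close>.\<close>

lemma finite_rho_image: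
  assumes no_parabolic: "\<And>g i j. g \<in> carrier W \<Longrightarrow> i < r \<Longrightarrow> j < r \<Longrightarrow>
      \<bar>form (\<rho> g *\<^sub>v unit_vec r i) (unit_vec r j)\<bar> = 2 \<Longrightarrow>
      \<rho> g *\<^sub>v unit_vec r i = unit_vec r j \<or> \<rho> g *\<^sub>v unit_vec r i = - unit_vec r j"
    and c_bound: "\<And>i j. i < r \<Longrightarrow> j < r \<Longrightarrow> \<bar>c i j\<bar> \<le> 2"
  shows "finite (\<rho> ` carrier W)"
proof -
  have uminus: "- v = 0\<^sub>v r - 1 \<cdot>\<^sub>v v" if "v \<in> carrier_vec r" for v :: "int vec"
    using that by (intro eq_vecI) auto
  have form_uminus: "form (- v) z = - form v z" if "v \<in> carrier_vec r" for v z
    using that by (simp add: form_def sum_negf)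
  have c_small: "\<bar>c i j\<bar> \<le> 1" if "i < r" "j < r" "i \<noteq> j" for i j
  proof (rule ccontr)
    assume "\<not> \<bar>c i j\<bar> \<le> 1"
    then have "\<bar>c i j\<bar> = 2" using c_bound[OF that(1,2)] by linarith
    then have "unit_vec r i = (unit_vec r j :: int vec) \<or> unit_vec r i = - (unit_vec r j :: int vec)"
      using no_parabolic[of \<one> i j] that by (simp add: rho_one)
    then have "(unit_vec r i :: int vec) $ i = (unit_vec r j :: int vec) $ i \<or>
        (unit_vec r i :: int vec) $ i = (- (unit_vec r j :: int vec)) $ i" by metis
    then show False using that by auto
  qed
  have bound: "\<bar>form (\<rho> g *\<^sub>v unit_vec r i) (unit_vec r j)\<bar> \<le> 2" if "g \<in> carrier W" "i < r" "j < r" for g i j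
    using that(1,3)
  proof (induction arbitrary: j rule: rho_induct)
    case one
    then show ?case using c_bound that by simp
  next
    case (reflection l h)
    note step = this
    define \<alpha> where "\<alpha> = \<rho> h *\<^sub>v unit_vec r i"
    have \<alpha>: "\<alpha> \<in> carrier_vec r" unfolding \<alpha>_def using step by (intro rho_vec) auto
    have cases: "\<alpha> = unit_vec r k \<or> \<alpha> = - unit_vec r k \<or> \<bar>pairing k \<alpha>\<bar> \<le> 1" if k: "k < r" for k
      using no_parabolic[OF step(2) \<open>i < r\<close> k] step(3)[OF k] k form_sym[of \<alpha> "unit_vec r k"]
      unfolding \<alpha>_def[symmetric] by fastforce
    have "reflection l * \<rho> h *\<^sub>v unit_vec r i = \<alpha> - pairing l \<alpha> \<cdot>\<^sub>v unit_vec r l"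
      using step rho_carrier[of h] \<alpha> by (simp add: assoc_mult_mat_vec[of _ r r _ r] \<alpha>_def[symmetric] reflection_apply)
    then have "form (reflection l * \<rho> h *\<^sub>v unit_vec r i) (unit_vec r j) = pairing j \<alpha> - pairing l \<alpha> * c j l"
      using step \<alpha> form_sym by (metis form_unit pairing_diff pairing_unit unit_vec_carrier)
    moreover have "\<bar>pairing j \<alpha> - pairing l \<alpha> * c j l\<bar> \<le> 2"
    proof (cases "j = l")
      case True
      then show ?thesis using step(3)[of j] step c_diag form_sym[of \<alpha> "unit_vec r j"]
        by (simp add: \<alpha>_def[symmetric])
    next
      case jl: False
      have cjl: "c j l = 1 \<or> c j l = 0 \<or> c j l = -1" using c_small[of j l] jl step by linarith
      consider "\<alpha> = unit_vec r l \<or> \<alpha> = - unit_vec r l" | "\<alpha> = unit_vec r j \<or> \<alpha> = - unit_vec r j"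
        | "\<bar>pairing l \<alpha>\<bar> \<le> 1" "\<bar>pairing j \<alpha>\<bar> \<le> 1"
        using cases[of l] cases[of j] step by blast
      then show ?thesis
      proof cases
        case 1
        then have "pairing j \<alpha> = c j l \<and> pairing l \<alpha> = 2 \<or> pairing j \<alpha> = - c j l \<and> pairing l \<alpha> = - 2"
          using step c_diag form_sym[of \<alpha> "unit_vec r j"] form_sym[of \<alpha> "unit_vec r l"] c_sym
          by (auto simp: form_uminus)
        then show ?thesis using cjl by auto
      next
        case 2
        then have "pairing j \<alpha> = 2 \<and> pairing l \<alpha> = c j l \<or> pairing j \<alpha> = - 2 \<and> pairing l \<alpha> = - c j l"
          using step c_diag form_sym[of \<alpha> "unit_vec r j"] form_sym[of \<alpha> "unit_vec r l"] c_sym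
          by (auto simp: form_uminus)
        then show ?thesis using cjl by auto
      next
        case 3
        then show ?thesis using cjl by auto
      qed
    qed
    ultimately show ?case by simp
  qed
  define \<Phi> where "\<Phi> g = (\<lambda>(i, j)\<in>{..<r} \<times> {..<r}. form (\<rho> g *\<^sub>v unit_vec r i) (unit_vec r j))" for g
  have "finite (\<Phi> ` carrier W)"
  proof (rule finite_subset)
    show "\<Phi> ` carrier W \<subseteq> ({..<r} \<times> {..<r}) \<rightarrow>\<^sub>E {-2..2}"
    proof
      fix f assume "f \<in> \<Phi> ` carrier W"
      then obtain g where g: "g \<in> carrier W" and f: "f = \<Phi> g" by auto
      have "form (\<rho> g *\<^sub>v unit_vec r i) (unit_vec r j) \<in> {-2..2}" if "i < r" "j < r" for i j
        using bound[OF g that] by (simp add: abs_le_iff)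
      then show "f \<in> ({..<r} \<times> {..<r}) \<rightarrow>\<^sub>E {-2..2}"
        by (auto simp: f \<Phi>_def)
    qed
  qed (auto intro: finite_PiE)
  moreover have "\<rho> g = \<rho> h" if g: "g \<in> carrier W" and h: "h \<in> carrier W" and eq: "\<Phi> g = \<Phi> h" for g h
  proof -
    have same_root: "\<rho> g *\<^sub>v unit_vec r i = \<rho> h *\<^sub>v unit_vec r i" if i: "i < r" for i
    proof -
      define \<alpha> where "\<alpha> = \<rho> g *\<^sub>v unit_vec r i"
      define \<beta> where "\<beta> = \<rho> h *\<^sub>v unit_vec r i"
      have \<alpha>: "\<alpha> \<in> carrier_vec r" "\<beta> \<in> carrier_vec r"
        unfolding \<alpha>_def \<beta>_def using g h by (auto intro: rho_vec)
      have "form \<alpha> (unit_vec r k) = form \<beta> (unit_vec r k)" if "k < r" for k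
        using fun_cong[OF eq, of "(i, k)"] that i by (simp add: \<Phi>_def \<alpha>_def \<beta>_def)
      then have "pairing k \<alpha> = pairing k \<beta>" if "k < r" for k
        using that form_sym by (metis form_unit)
      then have "form \<beta> \<alpha> = form \<beta> \<beta>" by (simp add: form_def)
      also have "\<dots> = 2" unfolding \<beta>_def using h i c_diag by (simp add: rho_preserves_form)
      finally have two: "form (\<rho> h *\<^sub>v unit_vec r i) \<alpha> = 2" by (simp add: \<beta>_def)
      define k where "k = inv h \<otimes> g"
      have k: "k \<in> carrier W" using g h by (simp add: k_def)
      have k_root: "\<rho> k *\<^sub>v unit_vec r i = \<rho> (inv h) *\<^sub>v \<alpha>"
        unfolding k_def \<alpha>_def using g h by (simp add: rho_mult_vec)
      have k_two: "form (\<rho> k *\<^sub>v unit_vec r i) (unit_vec r i) = 2"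
        unfolding k_root using form_move[OF h, of "unit_vec r i" \<alpha>] two \<alpha> form_sym by simp
      moreover have "\<rho> k *\<^sub>v unit_vec r i \<noteq> - unit_vec r i"
        using k_two i c_diag by (auto simp: form_uminus)
      ultimately have "\<rho> k *\<^sub>v unit_vec r i = unit_vec r i"
        using no_parabolic[OF k i i] by auto
      then have "\<rho> h *\<^sub>v (\<rho> (inv h) *\<^sub>v \<alpha>) = \<rho> h *\<^sub>v unit_vec r i" by (simp add: k_root)
      then show ?thesis using rho_inverse_vec(1)[OF h \<alpha>(1)] by (simp add: \<alpha>_def)
    qed
    show ?thesis
    proof (rule eq_matI)
      fix a b assume "a < dim_row (\<rho> h)" "b < dim_col (\<rho> h)"
      then have ab: "a < r" "b < r" using rho_carrier[OF h] by auto
      show "\<rho> g $$ (a, b) = \<rho> h $$ (a, b)"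
        using mult_mat_unit_vec[OF rho_carrier[OF g] ab] mult_mat_unit_vec[OF rho_carrier[OF h] ab]
          same_root[OF ab(2)] by simp
    qed (use rho_carrier[OF g] rho_carrier[OF h] in auto)
  qed
  ultimately show ?thesis by (rule finite_image_factor)
qed

text \<open>Either there is a product of reflections as above, with a power in \<open>F\<close>, or \<open>\<rho>\<close> has finite
  image and a power of the free generator \<open>a\<close> is in its kernel.\<close>

lemma exists_congruence_torsion:
  assumes c_bound: "\<And>i j. i < r \<Longrightarrow> j < r \<Longrightarrow> \<bar>c i j\<bar> \<le> 2"
    and F: "finite_index_subgroup F W"
    and pres: "has_presentation (W\<lparr>carrier := F\<rparr>) X (\<lambda>x. x) {}" and a: "a \<in> X"
  obtains x where "x \<in> F" "x \<noteq> \<one>" "congruence_torsion x"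
proof (cases "\<exists>g i j. g \<in> carrier W \<and> i < r \<and> j < r \<and>
      \<bar>form (\<rho> g *\<^sub>v unit_vec r i) (unit_vec r j)\<bar> = 2 \<and>
      \<rho> g *\<^sub>v unit_vec r i \<noteq> unit_vec r j \<and> \<rho> g *\<^sub>v unit_vec r i \<noteq> - unit_vec r j")
  case True
  then obtain g i j where gij: "g \<in> carrier W" "i < r" "j < r"
      "\<bar>form (\<rho> g *\<^sub>v unit_vec r i) (unit_vec r j)\<bar> = 2"
      "\<rho> g *\<^sub>v unit_vec r i \<noteq> unit_vec r j" "\<rho> g *\<^sub>v unit_vec r i \<noteq> - unit_vec r j"
    by blast
  define u where "u = (g \<otimes> w i \<otimes> inv g) \<otimes> w j"
  have u: "u \<in> carrier W" using gij w_carrier by (auto simp: u_def)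
  obtain n :: nat where n: "0 < n" "u [^] n \<in> F" using finite_index_pow_mem[OF F u] .
  show thesis
    using that[of "u [^] n"] n parabolic_product[OF gij] congruence_torsion_pow[OF u]
    by (simp add: u_def)
next
  case False
  have sub: "subgroup F W" using F by (simp add: finite_index_subgroup_def)
  have FG: "group (W\<lparr>carrier := F\<rparr>)" using subgroup_imp_group[OF sub] .
  have aF: "a \<in> F" using has_presentation_generates(1)[OF FG pres] a by auto
  then have ac: "a \<in> carrier W" using subgroup.mem_carrier[OF sub] by blast
  have "finite (\<rho> ` carrier W)" by (rule finite_rho_image[OF _ c_bound]) (use False in blast)+
  then obtain i j :: nat where ij: "i < j" "\<rho> (a [^] i) = \<rho> (a [^] j)"
    using finite_range_pow_repeats[OF _ ac] by blast
  define x where "x = a [^] (j - i)"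
  have xc: "x \<in> carrier W" using ac by (simp add: x_def)
  have "\<rho> x = \<rho> (a [^] j) * \<rho> (inv (a [^] i))"
    using ac ij pow_diff[OF ac, of i j] by (simp add: x_def rho_mult[symmetric])
  also have "\<dots> = \<rho> (a [^] i) * \<rho> (inv (a [^] i))" by (simp only: ij(2))
  also have "\<dots> = \<rho> (a [^] i \<otimes> inv (a [^] i))" using ac by (intro rho_mult[symmetric]) auto
  finally have x1: "\<rho> x = 1\<^sub>m r" using ac by (simp add: rho_one)
  have "congruence_torsion x"
    unfolding congruence_torsion_def using mat_cong_rho_pow[OF xc] by (simp add: x1)
  moreover have "x \<in> F"
    using monoid.nat_pow_closed[OF group.is_monoid[OF FG], of a "j - i"] aF
    by (simp add: x_def nat_pow_consistent[symmetric])
  moreover have "x \<noteq> \<one>"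
    using free_generator_pow_neq_one[OF FG pres a, of "j - i"] ij
    by (simp add: x_def nat_pow_consistent[symmetric])
  ultimately show thesis using that by blast
qed

end

section \<open>Virtually free small Coxeter groups\<close>

lemma (in group) commutes_with_inverse:
  assumes "z \<otimes> x = x \<otimes> z" "z \<in> carrier G" "x \<in> carrier G"
  shows "z \<otimes> inv x = inv x \<otimes> z"
proof -
  have "z \<otimes> inv x = inv x \<otimes> (x \<otimes> z) \<otimes> inv x" using assms(2,3) by (simp add: m_assoc[symmetric])
  also have "\<dots> = inv x \<otimes> (z \<otimes> x) \<otimes> inv x" by (simp only: assms(1))
  also have "\<dots> = inv x \<otimes> z" using assms(2,3) by (simp add: m_assoc)
  finally show ?thesis .
qed

text \<open>The default case stands for the exponent \<open>\<infinity>\<close>, the only value besides \<open>1\<close>, \<open>2\<close> and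
  \<open>3\<close> that occurs in a small Coxeter system.\<close>

definition cartan_entry :: "enat \<Rightarrow> int" where
  "cartan_entry e = (if e = 1 then 2 else if e = 2 then 0 else if e = 3 then -1 else -2)"

lemma cartan_entry_bound: "\<bar>cartan_entry e\<bar> \<le> 2"
  by (simp add: cartan_entry_def)

lemma small_exponent_cases:
  assumes "1 \<le> e" "e = \<infinity> \<or> e \<le> (3 :: enat)"
  obtains "e = enat 1" | "e = enat 2" | "e = enat 3" | "e = \<infinity>"
proof (cases e)
  case (enat k)
  then have "k = 1 \<or> k = 2 \<or> k = 3" using assms by (auto simp: one_enat_def numeral_eq_enat)
  then show thesis using that enat by blast
qed (use that in blast)

lemma cartan_entry_simps [simp]:
  "cartan_entry (enat (Suc 0)) = 2" "cartan_entry (enat 2) = 0" "cartan_entry (enat 3) = -1"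
  "cartan_entry \<infinity> = -2"
  by (simp_all add: cartan_entry_def one_enat_def numeral_eq_enat)

lemma tits_form_basis_cartan_entry:
  assumes "1 \<le> m i j" "m i j = \<infinity> \<or> m i j \<le> 3"
  shows "2 * tits_form_basis m i j = real_of_int (cartan_entry (m i j))"
  by (rule small_exponent_cases[OF assms])
    (simp_all add: tits_form_basis_def cos_60)

text \<open>For involutions, \<open>(ab)\<^sup>2 = 1\<close> is commutation and \<open>(ab)\<^sup>3 = 1\<close> is the braid relation
  \<open>aba = bab\<close>; these are the relations verified for reflections.\<close>

lemma (in cartan_matrix) coxeter_relation_int_gl:
  assumes "i < r" "j < r" and "k = 1 \<and> i = j \<or> k = 2 \<and> c i j = 0 \<or> k = 3 \<and> c i j = -1"
  shows "word_eval (int_gl r) reflection (concat (replicate k [(i, True), (j, True)])) = 1\<^sub>m r"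
proof -
  define a where "a = reflection i"
  define b where "b = reflection j"
  have ab: "a \<in> carrier_mat r r" "b \<in> carrier_mat r r" by (simp_all add: a_def b_def)
  have sq: "a * a = 1\<^sub>m r" "b * b = 1\<^sub>m r" using assms reflection_involution by (simp_all add: a_def b_def)
  note simps = units_ring_mat_simps(1,2) a_def[symmetric] b_def[symmetric]
  from assms(3) show ?thesis
  proof (elim disjE conjE)
    assume "k = 1" "i = j"
    then show ?thesis using ab sq by (simp add: simps)
  next
    assume k: "k = 2" and "c i j = 0"
    then have "a * b = b * a" using reflection_commute assms by (simp add: a_def b_def)
    then have "a * (b * (a * b)) = a * (b * (b * a))" by simp
    also have "\<dots> = a * ((b * b) * a)" using ab by (simp add: assoc_mult_mat[of _ r r _ r _ r])
    also have "\<dots> = 1\<^sub>m r" using ab sq by simp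
    finally show ?thesis using k ab by (simp add: simps numeral_2_eq_2)
  next
    assume k: "k = 3" and "c i j = -1"
    then have braid: "a * (b * a) = b * (a * b)" using reflection_braid assms by (simp add: a_def b_def)
    have "a * (b * (a * (b * (a * b)))) = (a * (b * a)) * (b * (a * b))"
      using ab by (simp add: assoc_mult_mat[of _ r r _ r _ r])
    also have "\<dots> = (a * (b * a)) * (a * (b * a))" by (simp only: braid)
    also have "\<dots> = a * (b * ((a * a) * (b * a)))"
      using ab by (simp add: assoc_mult_mat[of _ r r _ r _ r])
    also have "\<dots> = a * (b * (b * a))" unfolding sq using ab by simp
    also have "\<dots> = a * ((b * b) * a)" using ab by (simp add: assoc_mult_mat[of _ r r _ r _ r])
    also have "\<dots> = 1\<^sub>m r" using ab sq by simp
    finally show ?thesis using k ab by (simp add: simps numeral_3_eq_3)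
  qed
qed

lemma small_coxeter_reflection_representation:
  assumes "small_coxeter_system W r w m"
  obtains \<rho> where "reflection_representation r (\<lambda>i j. cartan_entry (m i j)) W w \<rho>"
proof -
  have W: "group W" and cm: "coxeter_matrix r m" and pres: "has_presentation W {..<r} w (coxeter_relations r m)"
    and small: "\<And>i j. i < r \<Longrightarrow> j < r \<Longrightarrow> m i j = \<infinity> \<or> m i j \<le> 3"
    using assms by (auto simp: small_coxeter_system_def coxeter_system_def)
  have m: "1 \<le> m i j" "m i j = m j i" "m i j = 1 \<longleftrightarrow> i = j" if "i < r" "j < r" for i j
    using cm that unfolding coxeter_matrix_def by blast+
  define c where "c = (\<lambda>i j. cartan_entry (m i j))"
  interpret cartan_matrix r c
    by unfold_locales (use m in \<open>auto simp: c_def cartan_entry_def\<close>)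
  have gens: "reflection \<in> {..<r} \<rightarrow> carrier (int_gl r)" using reflection_in_int_gl by auto
  have rel: "word_eval (int_gl r) reflection p = word_eval (int_gl r) reflection q"
    if pq: "(p, q) \<in> coxeter_relations r m" for p q
  proof -
    obtain i j k where ijk: "i < r" "j < r" "m i j = enat k"
      "p = concat (replicate k [(i, True), (j, True)])" "q = []"
      using pq unfolding coxeter_relations_def by blast
    have "k = 1 \<and> i = j \<or> k = 2 \<and> c i j = 0 \<or> k = 3 \<and> c i j = -1"
      by (rule small_exponent_cases[OF m(1)[OF ijk(1,2)] small[OF ijk(1,2)]])
        (use ijk m(3)[OF ijk(1,2)] in \<open>auto simp: c_def one_enat_def\<close>)
    then show ?thesis
      using coxeter_relation_int_gl[OF ijk(1,2)] ijk by (simp add: units_ring_mat_simps(2))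
  qed
  obtain \<rho> where "\<rho> \<in> hom W (int_gl r)" "\<And>i. i \<in> {..<r} \<Longrightarrow> \<rho> (w i) = reflection i"
    by (rule has_presentation_lift[OF W pres group_units_ring_mat gens]) (rule rel, assumption, blast)
  then have "reflection_representation r c W w \<rho>"
    using has_presentation_generates[OF W pres] W
    by (intro reflection_representation.intro reflection_representation_axioms.intro cartan_matrix_axioms) auto
  then show thesis using that by (simp add: c_def)
qed

lemma virtually_free_small_coxeter_no_congruence_subgroup_property:
  assumes small: "small_coxeter_system W r w m" and free: "virtually nonabelian_free_group W"
  shows "\<not> congruence_subgroup_property W r w m"
proof -
  obtain \<rho> where "reflection_representation r (\<lambda>i j. cartan_entry (m i j)) W w \<rho>"
    using small_coxeter_reflection_representation[OF small] .
  then interpret reflection_representation r "\<lambda>i j. cartan_entry (m i j)" W w \<rho> .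
  have basis: "2 * tits_form_basis m i j = real_of_int (cartan_entry (m i j))" if "i < r" "j < r" for i j
    using small that
    by (intro tits_form_basis_cartan_entry)
      (auto simp: small_coxeter_system_def coxeter_system_def coxeter_matrix_def)
  obtain F where F: "finite_index_subgroup F W" and free_F: "nonabelian_free_group (W\<lparr>carrier := F\<rparr>)"
    using free by (auto simp: virtually_def)
  define G where "G = W\<lparr>carrier := F\<rparr>"
  have G: "group G" and nonab: "\<not> comm_group G"
    using free_F by (auto simp: nonabelian_free_group_def free_group_def G_def)
  obtain X where pres: "has_presentation G X (\<lambda>x. x) {}"
    using free_F by (auto simp: nonabelian_free_group_def free_group_def G_def)
  interpret G: group G by fact
  \<comment> \<open>A free group with at most one generator is commutative.\<close>
  obtain a1 a2 where a: "a1 \<in> X" "a2 \<in> X" "a1 \<noteq> a2"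
  proof (rule ccontr)
    assume "\<not> thesis"
    then have single: "x = y" if "x \<in> X" "y \<in> X" for x y using that \<open>\<And>a1 a2. \<lbrakk>a1 \<in> X; a2 \<in> X; a1 \<noteq> a2\<rbrakk> \<Longrightarrow> thesis\<close> by blast
    note gen = has_presentation_generates[OF G pres]
    have comm: "z \<otimes>\<^bsub>G\<^esub> word_eval G (\<lambda>x. x) u = word_eval G (\<lambda>x. x) u \<otimes>\<^bsub>G\<^esub> z"
      if z: "z \<in> carrier G" and u: "u \<in> gwords X" and zX: "\<And>x. x \<in> X \<Longrightarrow> z \<otimes>\<^bsub>G\<^esub> x = x \<otimes>\<^bsub>G\<^esub> z" for z u
      using u
    proof (induction u)
      case Nil
      then show ?case using z by simp
    next
      case (Cons l u)
      define y where "y = (if snd l then fst l else inv\<^bsub>G\<^esub> fst l)"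
      define v where "v = word_eval G (\<lambda>x. x) u"
      have lX: "fst l \<in> X" "fst l \<in> carrier G" using Cons.prems gen(1) by auto
      have c: "y \<in> carrier G" "v \<in> carrier G"
        using lX Cons.prems G.word_eval_closed[OF gen(1)] by (auto simp: y_def v_def)
      have "z \<otimes>\<^bsub>G\<^esub> y = y \<otimes>\<^bsub>G\<^esub> z"
        using zX[OF lX(1)] lX z G.commutes_with_inverse by (auto simp: y_def)
      moreover have "z \<otimes>\<^bsub>G\<^esub> v = v \<otimes>\<^bsub>G\<^esub> z" using Cons by (simp add: v_def)
      ultimately have "z \<otimes>\<^bsub>G\<^esub> (y \<otimes>\<^bsub>G\<^esub> v) = (y \<otimes>\<^bsub>G\<^esub> v) \<otimes>\<^bsub>G\<^esub> z"
        using c z by (metis G.m_assoc)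
      moreover have "word_eval G (\<lambda>x. x) (l # u) = y \<otimes>\<^bsub>G\<^esub> v"
        by (cases l) (simp add: y_def v_def)
      ultimately show ?case by simp
    qed
    have "comm_group G"
    proof (rule G.group_comm_groupI)
      fix x y assume x: "x \<in> carrier G" and y: "y \<in> carrier G"
      obtain u where u: "u \<in> gwords X" "x = word_eval G (\<lambda>x. x) u" using gen(2) x by auto
      obtain v where v: "v \<in> gwords X" "y = word_eval G (\<lambda>x. x) v" using gen(2) y by auto
      have "s \<otimes>\<^bsub>G\<^esub> x = x \<otimes>\<^bsub>G\<^esub> s" if s: "s \<in> X" for s
        unfolding u(2) by (rule comm) (use s gen(1) u(1) single in auto)
      then show "x \<otimes>\<^bsub>G\<^esub> y = y \<otimes>\<^bsub>G\<^esub> x"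
        unfolding v(2) by (intro comm x v(1)) simp
    qed
    then show False using nonab by contradiction
  qed
  obtain x where x: "x \<in> F" "x \<noteq> \<one>\<^bsub>W\<^esub>" "congruence_torsion x"
    using exists_congruence_torsion[OF cartan_entry_bound F, of X a1] pres a by (auto simp: G_def)
  have xG: "x \<in> carrier G" "x \<noteq> \<one>\<^bsub>G\<^esub>" using x by (simp_all add: G_def)
  obtain Q :: "(nat \<times> nat \<Rightarrow> nat \<times> nat) monoid" and \<theta> h h'
    where Q: "group Q" "finite (carrier Q)" and \<theta>: "\<theta> \<in> hom G Q" and h: "h \<in> carrier G" "h' \<in> carrier G"
    and sep: "separated_pair Q (\<theta> (h \<otimes>\<^bsub>G\<^esub> x \<otimes>\<^bsub>G\<^esub> inv\<^bsub>G\<^esub> h)) (\<theta> (h' \<otimes>\<^bsub>G\<^esub> x \<otimes>\<^bsub>G\<^esub> inv\<^bsub>G\<^esub> h'))"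
    by (rule free_group_separates_conjugates[OF G pres a xG])
  have sub: "subgroup F W" using F by (simp add: finite_index_subgroup_def)
  have torsion: "h \<otimes>\<^bsub>G\<^esub> x \<otimes>\<^bsub>G\<^esub> inv\<^bsub>G\<^esub> h \<in> F \<and> congruence_torsion (h \<otimes>\<^bsub>G\<^esub> x \<otimes>\<^bsub>G\<^esub> inv\<^bsub>G\<^esub> h)"
    if "h \<in> carrier G" for h
  proof -
    have hF: "h \<in> F" using that by (simp add: G_def)
    then have "h \<in> carrier W" "x \<in> carrier W" using x subgroup.mem_carrier[OF sub] by auto
    moreover have "h \<otimes>\<^bsub>G\<^esub> x \<otimes>\<^bsub>G\<^esub> inv\<^bsub>G\<^esub> h = h \<otimes>\<^bsub>W\<^esub> x \<otimes>\<^bsub>W\<^esub> inv\<^bsub>W\<^esub> h"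
      using m_inv_consistent[OF sub hF] by (simp add: G_def)
    ultimately show ?thesis
      using congruence_torsion_conj[of x h] x hF subgroup.m_closed[OF sub] subgroup.m_inv_closed[OF sub] by simp
  qed
  show ?thesis
    by (rule no_congruence_subgroup_property[OF _ F Q, where \<theta> = \<theta>
          and x = "h \<otimes>\<^bsub>G\<^esub> x \<otimes>\<^bsub>G\<^esub> inv\<^bsub>G\<^esub> h" and y = "h' \<otimes>\<^bsub>G\<^esub> x \<otimes>\<^bsub>G\<^esub> inv\<^bsub>G\<^esub> h'"])
      (use basis torsion[OF h(1)] torsion[OF h(2)] \<theta> sep in \<open>simp_all add: G_def\<close>)
qed

section \<open>Triplet groups\<close>

text \<open>Triplet groups are presented with generators indexed from \<open>1\<close>, Coxeter systems with generators indexed from \<open>0\<close>.\<close>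

lemma word_eval_shift:
  fixes u :: "nat gword"
  shows "u \<in> gwords {1..<n} \<Longrightarrow>
    word_eval G g u = word_eval G (\<lambda>i. g (i + 1)) (map (\<lambda>(x, b). (x - 1, b)) u)"
  by (induction u) (auto simp: Suc_le_eq)

lemma gwords_shift:
  fixes u :: "nat gword"
  shows "u \<in> gwords {1..<n} \<Longrightarrow> map (\<lambda>(x, b). (x - 1, b)) u \<in> gwords {..<n - 1}"
  by (induction u) (auto intro: diff_less_mono)

lemma triplet_relations_word_eval:
  assumes K: "group K" and f: "f \<in> {1..<n} \<rightarrow> carrier K"
    and sq: "\<And>i. 1 \<le> i \<Longrightarrow> i < n \<Longrightarrow> f i \<otimes>\<^bsub>K\<^esub> f i = \<one>\<^bsub>K\<^esub>"
    and braid: "\<And>i. 1 \<le> i \<Longrightarrow> i + 1 < n \<Longrightarrow>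
      f i \<otimes>\<^bsub>K\<^esub> (f (i + 1) \<otimes>\<^bsub>K\<^esub> f i) = f (i + 1) \<otimes>\<^bsub>K\<^esub> (f i \<otimes>\<^bsub>K\<^esub> f (i + 1))"
    and pq: "(p, q) \<in> triplet_relations n"
  shows "word_eval K f p = word_eval K f q"
proof -
  interpret group K by fact
  have "f i \<in> carrier K" if "1 \<le> i" "i < n" for i using f that by auto
  then show ?thesis
    using pq sq braid unfolding triplet_relations_def by auto
qed

text \<open>An action of the triplet groups on seven points. The product of the first and third involution is
  \<open>(0 1)(2 4 3)(5 6)\<close>, and its conjugate by the second is \<open>(0 4)(1 3 5)(2 6)\<close>. The first swaps
  \<open>1\<close> and \<open>0\<close>, while for the second \<open>1\<close> has period three and \<open>0\<close> period two.
  All generators beyond the second act as the third involution, which satisfies the remaining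
  braid relations trivially.\<close>

definition involution1 :: "nat \<Rightarrow> nat" where
  "involution1 = transpose 3 4 \<circ> transpose 5 6"

definition involution2 :: "nat \<Rightarrow> nat" where
  "involution2 = transpose 1 4 \<circ> transpose 2 5"

definition involution3 :: "nat \<Rightarrow> nat" where
  "involution3 = transpose 0 1 \<circ> transpose 2 3"

definition triplet_perm :: "nat \<Rightarrow> nat \<Rightarrow> nat" where
  "triplet_perm i = (if i = 1 then involution1 else if i = 2 then involution2 else involution3)"

lemma triplet_perm_permutes: "triplet_perm i permutes {..<7}"
  unfolding triplet_perm_def involution1_def involution2_def involution3_def
  by (auto intro!: permutes_compose permutes_swap_id)

lemma permutes_eqI:
  assumes "p permutes S" "q permutes S" "\<And>x. x \<in> S \<Longrightarrow> p x = q x"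
  shows "p = q"
  using assms by (metis permutes_not_in ext)

lemma less_7_cases:
  assumes "x < (7::nat)"
  shows "x = 0 \<or> x = 1 \<or> x = 2 \<or> x = 3 \<or> x = 4 \<or> x = 5 \<or> x = 6"
  using assms by linarith

lemmas involution_defs = involution1_def involution2_def involution3_def

lemma triplet_perm_involution: "triplet_perm i \<circ> triplet_perm i = id"
proof -
  have "transpose a b \<circ> transpose c d \<circ> (transpose a b \<circ> transpose c d) = id"
    if "a \<noteq> c" "a \<noteq> d" "b \<noteq> c" "b \<noteq> d" for a b c d :: nat
    using that by (auto simp: fun_eq_iff transpose_def)
  then show ?thesis by (simp add: triplet_perm_def involution_defs)
qed

lemma triplet_perm_braid:
  assumes "1 \<le> i"
  shows "triplet_perm i \<circ> (triplet_perm (i + 1) \<circ> triplet_perm i) =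
    triplet_perm (i + 1) \<circ> (triplet_perm i \<circ> triplet_perm (i + 1))"
proof (rule permutes_eqI[where S = "{..<7}"])
  fix x :: nat assume "x \<in> {..<7}"
  then have x: "x = 0 \<or> x = 1 \<or> x = 2 \<or> x = 3 \<or> x = 4 \<or> x = 5 \<or> x = 6"
    by (intro less_7_cases) simp
  have "involution1 (involution2 (involution1 x)) = involution2 (involution1 (involution2 x))"
    "involution2 (involution3 (involution2 x)) = involution3 (involution2 (involution3 x))"
    using x by (elim disjE; simp add: involution_defs transpose_def)+
  then show "(triplet_perm i \<circ> (triplet_perm (i + 1) \<circ> triplet_perm i)) x =
      (triplet_perm (i + 1) \<circ> (triplet_perm i \<circ> triplet_perm (i + 1))) x"
    using assms by (auto simp: triplet_perm_def)
qed (intro permutes_compose triplet_perm_permutes)+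

lemma triplet_group_no_congruence_subgroup_property:
  assumes n: "4 \<le> n"
  shows "\<not> congruence_subgroup_property (triplet_group n) (n - 1) (triplet_gen n) triplet_exponent"
proof -
  define W where "W = triplet_group n"
  define r where "r = n - 1"
  define w where "w = triplet_gen n"
  define c where "c = (\<lambda>i j. cartan_entry (triplet_exponent i j))"
  define g where "g = pres_gen {1..<n} (triplet_relations n)"
  have W: "group W" unfolding W_def triplet_group_def by (rule group_presented_group)
  have pres: "has_presentation W {1..<n} g (triplet_relations n)"
    unfolding W_def triplet_group_def g_def by (rule has_presentation_presented_group)
  have w: "w = (\<lambda>i. g (i + 1))" by (simp add: w_def g_def triplet_gen_def fun_eq_iff)
  have c_eq: "c i j = (if i = j then 2 else if i = j + 1 \<or> j = i + 1 then -1 else -2)" for i j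
    by (simp add: c_def triplet_exponent_def cartan_entry_def)
  interpret cartan_matrix r c by unfold_locales (auto simp: c_eq)
  have gens: "(\<lambda>i. reflection (i - 1)) \<in> {1..<n} \<rightarrow> carrier (int_gl r)"
    using reflection_in_int_gl by (auto simp: r_def)
  have rel: "word_eval (int_gl r) (\<lambda>i. reflection (i - 1)) p = word_eval (int_gl r) (\<lambda>i. reflection (i - 1)) q"
    if "(p, q) \<in> triplet_relations n" for p q
  proof (rule triplet_relations_word_eval[OF group_units_ring_mat gens _ _ that])
    fix i assume i: "1 \<le> i" "i < n"
    then show "reflection (i - 1) \<otimes>\<^bsub>int_gl r\<^esub> reflection (i - 1) = \<one>\<^bsub>int_gl r\<^esub>"
      using reflection_involution[of "i - 1"] by (simp add: units_ring_mat_simps(1,2) r_def)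
  next
    fix i assume i: "1 \<le> i" "i + 1 < n"
    then have "c (i - 1) i = -1" by (simp add: c_eq)
    then show "reflection (i - 1) \<otimes>\<^bsub>int_gl r\<^esub> (reflection (i + 1 - 1) \<otimes>\<^bsub>int_gl r\<^esub> reflection (i - 1)) =
      reflection (i + 1 - 1) \<otimes>\<^bsub>int_gl r\<^esub> (reflection (i - 1) \<otimes>\<^bsub>int_gl r\<^esub> reflection (i + 1 - 1))"
      using reflection_braid[of "i - 1" i] i by (simp add: units_ring_mat_simps(1) r_def)
  qed
  obtain \<rho> where \<rho>: "\<rho> \<in> hom W (int_gl r)" "\<And>i. i \<in> {1..<n} \<Longrightarrow> \<rho> (g i) = reflection (i - 1)"
    by (rule has_presentation_lift[OF W pres group_units_ring_mat gens]) (rule rel, assumption, blast)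
  have g: "g \<in> {1..<n} \<rightarrow> carrier W" "carrier W = word_eval W g ` gwords {1..<n}"
    using has_presentation_generates[OF W pres] by auto
  have w_closed: "w \<in> {..<r} \<rightarrow> carrier W" using g(1) by (auto simp: w r_def)
  have "carrier W = word_eval W w ` gwords {..<r}"
  proof
    show "carrier W \<subseteq> word_eval W w ` gwords {..<r}"
      unfolding g(2) w r_def using word_eval_shift[of _ n W g] gwords_shift[of _ n] by blast
    show "word_eval W w ` gwords {..<r} \<subseteq> carrier W"
      using group.word_eval_closed[OF W w_closed] by auto
  qed
  then have "reflection_representation r c W w \<rho>"
    using w_closed W \<rho>
    by (intro reflection_representation.intro reflection_representation_axioms.intro cartan_matrix_axioms)
      (auto simp: w r_def)
  then interpret reflection_representation r c W w \<rho> .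

  have basis: "2 * tits_form_basis triplet_exponent i j = real_of_int (c i j)" for i j
    unfolding c_def by (rule tits_form_basis_cartan_entry) (simp_all add: triplet_exponent_def)

  define Q where "Q = perm_group {..<7::nat}"
  have Q: "group Q" "finite (carrier Q)"
    unfolding Q_def by (auto simp: group_perm_group intro: finite_perm_group)
  have perm_gens: "triplet_perm \<in> {1..<n} \<rightarrow> carrier Q"
    by (simp add: Q_def triplet_perm_permutes)
  have perm_rel: "word_eval Q triplet_perm p = word_eval Q triplet_perm q"
    if "(p, q) \<in> triplet_relations n" for p q
    by (rule triplet_relations_word_eval[OF Q(1) perm_gens _ _ that])
      (simp_all only: Q_def perm_group_simps triplet_perm_involution triplet_perm_braid)
  obtain \<theta> where \<theta>: "\<theta> \<in> hom W Q" "\<And>i. i \<in> {1..<n} \<Longrightarrow> \<theta> (g i) = triplet_perm i"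
    by (rule has_presentation_lift[OF W pres Q(1) perm_gens]) (rule perm_rel, assumption, blast)
  interpret \<theta>: group_hom W Q \<theta> using \<theta>(1) Q W by (simp add: group_hom_def group_hom_axioms_def)

  have idx: "0 < r" "1 < r" "2 < r" using n by (auto simp: r_def)
  define x where "x = (\<one>\<^bsub>W\<^esub> \<otimes>\<^bsub>W\<^esub> w 0 \<otimes>\<^bsub>W\<^esub> inv\<^bsub>W\<^esub> \<one>\<^bsub>W\<^esub>) \<otimes>\<^bsub>W\<^esub> w 2"
  have wc: "w 0 \<in> carrier W" "w 1 \<in> carrier W" "w 2 \<in> carrier W" using idx w_carrier by auto
  have xc: "x \<in> carrier W" using wc by (simp add: x_def)
  have "\<bar>form (\<rho> \<one>\<^bsub>W\<^esub> *\<^sub>v unit_vec r 0) (unit_vec r 2)\<bar> = 2"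
    using idx by (simp add: rho_one c_eq)
  moreover have "\<rho> \<one>\<^bsub>W\<^esub> *\<^sub>v unit_vec r 0 \<noteq> unit_vec r 2"
  proof
    assume "\<rho> \<one>\<^bsub>W\<^esub> *\<^sub>v unit_vec r 0 = unit_vec r 2"
    then have "(unit_vec r 0 :: int vec) $ 0 = unit_vec r 2 $ 0" by (simp add: rho_one)
    then show False using idx by simp
  qed
  moreover have "\<rho> \<one>\<^bsub>W\<^esub> *\<^sub>v unit_vec r 0 \<noteq> - unit_vec r 2"
  proof
    assume "\<rho> \<one>\<^bsub>W\<^esub> *\<^sub>v unit_vec r 0 = - unit_vec r 2"
    then have "(unit_vec r 0 :: int vec) $ 0 = (- unit_vec r 2) $ 0" by (simp add: rho_one)
    then show False using idx by simp
  qed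
  ultimately have x: "congruence_torsion x"
    unfolding x_def using idx by (intro parabolic_product(1)) auto
  define y where "y = w 1 \<otimes>\<^bsub>W\<^esub> x \<otimes>\<^bsub>W\<^esub> inv\<^bsub>W\<^esub> (w 1)"
  have yc: "y \<in> carrier W" using wc xc by (simp add: y_def)
  have y: "congruence_torsion y" unfolding y_def by (rule congruence_torsion_conj[OF xc wc(2) x])
  have \<theta>w: "\<theta> (w 0) = involution1" "\<theta> (w 1) = involution2" "\<theta> (w 2) = involution3"
    using \<theta>(2)[of 1] \<theta>(2)[of 2] \<theta>(2)[of 3] n by (simp_all add: w triplet_perm_def numeral_eq_Suc)
  have "involution2 permutes {..<7}" using triplet_perm_permutes[of 2] by (simp add: triplet_perm_def)
  moreover have "involution2 \<circ> involution2 = id" using triplet_perm_involution[of 2] by (simp add: triplet_perm_def)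
  ultimately have "inv\<^bsub>Q\<^esub> involution2 = involution2"
    unfolding Q_def by (intro group.inv_equality[OF group_perm_group]) auto
  then have \<theta>y: "\<theta> y = involution2 \<circ> (involution1 \<circ> involution3) \<circ> involution2"
    and \<theta>x: "\<theta> x = involution1 \<circ> involution3"
    using wc by (simp_all add: y_def x_def \<theta>w del: One_nat_def) (simp_all add: Q_def o_assoc)
  have "separated_pair Q (\<theta> x) (\<theta> y)"
    unfolding Q_def
    by (rule separated_pair_perm_group[where p = 1 and q = 0])
      (simp_all add: \<theta>x \<theta>y involution1_def involution2_def involution3_def transpose_def)
  moreover have "finite_index_subgroup (carrier W) W"
  proof -
    have "rcosets\<^bsub>W\<^esub> (carrier W) \<subseteq> {carrier W}"
      using coset_join2[OF _ subgroup_self] by (auto simp: RCOSETS_def)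
    then show ?thesis using subgroup_self finite_subset by (auto simp: finite_index_subgroup_def)
  qed
  ultimately have "\<not> congruence_subgroup_property W r w triplet_exponent"
    using no_congruence_subgroup_property[OF basis _ Q, of "carrier W" \<theta> x y] \<theta>(1) x y xc yc by simp
  then show ?thesis by (simp add: W_def r_def w_def)
qed

theorem proposition3p11:
  fixes W :: "('a, 'b) monoid_scheme"
    and r :: nat
    and w :: "nat \<Rightarrow> 'a"
    and m :: "nat \<Rightarrow> nat \<Rightarrow> enat"
  shows "(small_coxeter_system W r w m \<and> virtually nonabelian_free_group W
          \<longrightarrow> \<not> congruence_subgroup_property W r w m)
       \<and> (\<forall>n\<ge>4. \<not> congruence_subgroup_property
              (triplet_group n) (n - 1) (triplet_gen n) triplet_exponent)"
  using virtually_free_small_coxeter_no_congruence_subgroup_property triplet_group_no_congruence_subgroup_property by blast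

end
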